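(* Let $\phi=\frac{1+\sqrt5}{2}$. Then (1) $\displaystyle\lim_{g\to\infty}\frac{1}{g^2}\mathbb{E}_g[w(S)] = \frac{1}{10\phi}$, and (2) for every fixed $\epsilon>0$, $\displaystyle\lim_{g\to\infty}\mathbb{P}_{g}\left[\left|w(S)-\frac{1}{10\phi} g^2 \right|< \epsilon g^2\right] = 1$.
   Context: A numerical semigroup $S$ is a submonoid of $\mathbb{N}_0$ with finite complement; $\mathcal{H}(S)=\mathbb{N}_0\setminus S$ is its set of gaps and $g=g(S)=|\mathcal{H}(S)|$ its genus. The weight of $S$ is $w(S)=\left(\sum_{x\in\mathcal{H}(S)}x\right)-\frac{g(g+1)}{2}$. $\mathcal{S}_g$ is the finite set of numerical semigroups of genus $g$; $\mathbb{P}_g$ and $\mathbb{E}_g$ denote probability and expectation with respect to the uniform distribution on $\mathcal{S}_g$. *)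

theory Defs
  imports "HOL-Analysis.Analysis"
begin

definition numerical_semigroup :: "nat set \<Rightarrow> bool" where
  "numerical_semigroup S \<longleftrightarrow> 0 \<in> S \<and> (\<forall>x\<in>S. \<forall>y\<in>S. x + y \<in> S) \<and> finite (UNIV - S)"

definition gaps :: "nat set \<Rightarrow> nat set" where
  "gaps S = UNIV - S"

definition genus :: "nat set \<Rightarrow> nat" where
  "genus S = card (gaps S)"

definition weight :: "nat set \<Rightarrow> int" where
  "weight S = int (\<Sum>x\<in>gaps S. x) - int (genus S * (genus S + 1) div 2)"

definition semigroups_of_genus :: "nat \<Rightarrow> nat set set" where
  "semigroups_of_genus g = {S. numerical_semigroup S \<and> genus S = g}"

definition expect_g :: "nat \<Rightarrow> (nat set \<Rightarrow> real) \<Rightarrow> real" where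
  "expect_g g f = (\<Sum>S\<in>semigroups_of_genus g. f S) / real (card (semigroups_of_genus g))"

definition prob_g :: "nat \<Rightarrow> (nat set \<Rightarrow> bool) \<Rightarrow> real" where
  "prob_g g P = real (card {S\<in>semigroups_of_genus g. P S}) / real (card (semigroups_of_genus g))"

definition golden_ratio :: real where
  "golden_ratio = (1 + sqrt 5) / 2"

end

theory Submission
  imports Defs "HOL-Number_Theory.Fib"
begin

text \<open>
  A numerical semigroup of multiplicity \<open>m\<close> is determined by its Kunz coordinates
  \<open>k\<^sub>1, \<dots>, k\<^sub>m\<^sub>-\<^sub>1 \<ge> 1\<close>, where \<open>k\<^sub>i\<close> counts the gaps congruent to \<open>i\<close>; their sum is the genus,
  and \<open>k\<^sub>i\<^sub>+\<^sub>j \<le> k\<^sub>i + k\<^sub>j\<close>, with an extra \<open>+ 1\<close> on the right if \<open>i + j\<close> wraps around \<open>m\<close>.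
  Giving each tuple the weight \<open>\<psi>\<close> to the power of its sum, where \<open>\<psi> = 1 / \<phi>\<close>, the values \<open>1\<close> and \<open>2\<close>
  have total weight \<open>\<psi> + \<psi>\<^sup>2 = 1\<close>. Since there are at least \<open>\<psi> \<phi>\<^sup>g\<close> semigroups of genus \<open>g\<close>, any
  family of tuples whose weight decays exponentially in \<open>m\<close> is negligible.

  Many coordinates \<open>k\<^sub>c \<ge> M \<ge> 3\<close> force \<open>k\<^sub>i + k\<^sub>c\<^sub>-\<^sub>i \<ge> M\<close> along many reflections \<open>i \<mapsto> c - i\<close>. A container
  argument replaces this, up to \<open>e\<close> to the power \<open>o(m)\<close> many choices, by independent lower bounds \<open>L\<^sub>i\<close> with
  \<open>L\<^sub>i + L\<^sub>c\<^sub>-\<^sub>i \<ge> M\<close> along one reflection, and then each pair contributes a factor at most \<open>1 - \<psi>\<^sup>3\<close>. So almost all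
  coordinates are \<open>1\<close> or \<open>2\<close> and behave like independent variables that take the value \<open>2\<close> with probability
  \<open>\<psi>\<^sup>2\<close>; a Chernoff bound for \<open>\<Sum> k\<^sub>i\<close> and \<open>\<Sum> i k\<^sub>i\<close> determines the weight up to \<open>o(g\<^sup>2)\<close>. Multiplicities
  \<open>m \<le> g / 20\<close> are excluded by counting all compositions of \<open>g\<close>.
\<close>

section \<open>Weighted counting\<close>

text \<open>The reciprocal of \<open>golden_ratio\<close> (see \<open>psi_golden\<close>), written
  as a difference so that \<open>psi^2 = 1 - psi\<close> is plain arithmetic with
  \<open>sqrt 5\<close>.\<close>

definition psi :: real where
  "psi = golden_ratio - 1"

lemma psi_bounds: "0.618 < psi" "psi < 0.6181"
proof -
  have "2.236 < sqrt (5::real)" by (rule real_less_rsqrt) (simp add: power2_eq_square)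
  moreover have "sqrt (5::real) < 2.2362" by (rule real_less_lsqrt) (simp_all add: power2_eq_square)
  ultimately show "0.618 < psi" "psi < 0.6181"
    by (simp_all add: psi_def golden_ratio_def)
qed

lemma psi_pos [simp]: "0 < psi" "0 \<le> psi" "psi \<noteq> 0" and psi_less_1 [simp]: "psi < 1" "psi \<le> 1" "psi \<noteq> 1"
  using psi_bounds by auto

lemma psi_square: "psi^2 = 1 - psi"
proof -
  have "sqrt 5 * sqrt 5 = (5::real)" by simp
  then show ?thesis by (simp add: psi_def golden_ratio_def power2_eq_square field_simps)
qed

lemma psi_mult: "psi * psi = 1 - psi"
  using psi_square by (simp add: power2_eq_square)

lemma golden_eq: "golden_ratio = 1 + psi"
  by (simp add: psi_def)

lemma golden_pos [simp]: "0 < golden_ratio"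
  by (simp add: golden_eq add_pos_pos)

lemma psi_golden: "psi * golden_ratio = 1"
  by (simp add: golden_eq distrib_left psi_mult)

section \<open>Sparse subsets and product weights\<close>

text \<open>Each counted set has \<open>y ^ card Z\<close> at least \<open>y ^ t\<close> because
  \<open>y\<close> is at most 1, and the sum of \<open>y ^ card Z\<close> over all subsets is the
  generating function \<open>(1 + y) ^ card A\<close>.\<close>

lemma card_small_subsets_le:
  assumes "finite A" "0 < y" "y \<le> (1::real)"
  shows "real (card {Z. Z \<subseteq> A \<and> card Z \<le> t}) \<le> (1 + y) ^ card A / y ^ t"
proof -
  have fin: "finite {Z. Z \<subseteq> A \<and> card Z \<le> t}"
    using assms(1) by (auto intro: finite_subset[OF _ finite_Pow_iff[THEN iffD2, OF assms(1)]])
  have "real (card {Z. Z \<subseteq> A \<and> card Z \<le> t}) * y ^ t = (\<Sum>Z\<in>{Z. Z \<subseteq> A \<and> card Z \<le> t}. y ^ t)"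
    by simp
  also have "\<dots> \<le> (\<Sum>Z\<in>{Z. Z \<subseteq> A \<and> card Z \<le> t}. y ^ card Z)"
    using assms by (intro sum_mono power_decreasing) auto
  also have "\<dots> \<le> (\<Sum>Z\<in>Pow A. y ^ card Z)"
    using assms by (intro sum_mono2) auto
  also have "\<dots> = (\<Prod>a\<in>A. y + 1)"
  proof -
    have "(\<Prod>a\<in>A. y + 1) = (\<Sum>Z\<in>Pow A. (\<Prod>a\<in>Z. y) * (\<Prod>a\<in>A-Z. 1))"
      by (rule prod_add) (use assms in auto)
    then show ?thesis by simp
  qed
  finally show ?thesis using assms by (simp add: field_simps)
qed

text \<open>Entropy estimate that makes the choice of a sparse set affordable in the union bounds
  below. Half of the exponent pays for \<open>(1 + y) ^ card A\<close>, half for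
  \<open>1 / y ^ t\<close>.\<close>

lemma small_subset_rate:
  assumes "0 < (\<kappa>::real)"
  obtains \<delta> where "0 < (\<delta>::real)" and
    "\<And>(A::'a set) t. finite A \<Longrightarrow> real t \<le> \<delta> * card A \<Longrightarrow>
      real (card {Z. Z \<subseteq> A \<and> card Z \<le> t}) \<le> exp (\<kappa> * card A)"
proof -
  define y where "y = min 1 (\<kappa> / 2)"
  \<comment> \<open>The summand 1 keeps the denominator positive when \<open>y = 1\<close>.\<close>
  define \<delta> where "\<delta> = \<kappa> / (2 * (1 - ln y))"
  have y: "0 < y" "y \<le> 1" "y \<le> \<kappa> / 2" using assms by (auto simp: y_def)
  have ln: "ln y \<le> 0" using y by simp
  show thesis
  proof (rule that)
    show "0 < \<delta>" using assms ln by (simp add: \<delta>_def)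
    fix A :: "'a set" and t
    assume A: "finite A" and t: "real t \<le> \<delta> * card A"
    have "real t * (- ln y) \<le> \<delta> * card A * (1 - ln y)"
      using t ln \<open>0 < \<delta>\<close> by (intro mult_mono) auto
    also have "\<dots> = \<kappa> / 2 * card A" using ln by (simp add: \<delta>_def field_simps)
    finally have 1: "real t * (- ln y) \<le> \<kappa> / 2 * card A" .
    have "real (card {Z. Z \<subseteq> A \<and> card Z \<le> t}) \<le> (1 + y) ^ card A / y ^ t"
      by (rule card_small_subsets_le) (use A y in auto)
    also have "\<dots> \<le> exp y ^ card A / y ^ t"
      using y by (intro divide_right_mono power_mono) auto
    also have "\<dots> = exp (y * card A + real t * (- ln y))"
    proof -
      have "y ^ t = exp (real t * ln y)" using y by (simp add: exp_of_nat_mult)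
      moreover have "exp (y * card A) = exp y ^ card A" by (rule exp_of_nat2_mult)
      ultimately show ?thesis by (simp add: exp_diff)
    qed
    also have "\<dots> \<le> exp (\<kappa> * card A)"
    proof -
      have "y * card A \<le> \<kappa> / 2 * card A" using y by (intro mult_right_mono) auto
      with 1 show ?thesis by simp
    qed
    finally show "real (card {Z. Z \<subseteq> A \<and> card Z \<le> t}) \<le> exp (\<kappa> * card A)" .
  qed
qed

text \<open>Rankin's trick: each member of \<open>Q\<close> carries product weight at least
  \<open>B\<close>, and the total weight of the box factorises over the coordinates.\<close>

lemma card_PiE_weighted_le:
  fixes w :: "'a \<Rightarrow> 'b \<Rightarrow> real"
  assumes "finite I" "\<And>i. i \<in> I \<Longrightarrow> finite (V i)"
    and "\<And>i v. i \<in> I \<Longrightarrow> v \<in> V i \<Longrightarrow> 0 \<le> w i v"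
    and Q: "\<And>k. k \<in> Q \<Longrightarrow> k \<in> PiE I V \<and> B \<le> (\<Prod>i\<in>I. w i (k i))"
  shows "real (card Q) * B \<le> (\<Prod>i\<in>I. \<Sum>v\<in>V i. w i v)"
proof -
  have fin: "finite (PiE I V)" using assms by (intro finite_PiE) auto
  have "real (card Q) * B = (\<Sum>k\<in>Q. B)" by simp
  also have "\<dots> \<le> (\<Sum>k\<in>Q. \<Prod>i\<in>I. w i (k i))" using Q by (intro sum_mono) auto
  also have "\<dots> \<le> (\<Sum>k\<in>PiE I V. \<Prod>i\<in>I. w i (k i))"
    using Q fin assms(3) by (intro sum_mono2) (auto intro!: prod_nonneg simp: PiE_def Pi_def)
  also have "\<dots> = (\<Prod>i\<in>I. \<Sum>v\<in>V i. w i v)"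
    by (rule prod_sum_PiE[symmetric]) (use assms in auto)
  finally show ?thesis .
qed

text \<open>Bounded by the infinite geometric tail, whose denominator \<open>1 - psi\<close> is
  \<open>psi ^ 2\<close>; hence uniform in \<open>U\<close>.\<close>

lemma sum_psi_power_le: "(\<Sum>v=L..U. psi ^ v) \<le> psi ^ L / psi ^ 2"
proof (cases "L \<le> U")
  case True
  have "(\<Sum>v=L..U. psi ^ v) = (psi ^ L - psi ^ Suc U) / (1 - psi)"
    using True by (simp add: sum_gp)
  also have "\<dots> \<le> psi ^ L / (1 - psi)" by (intro divide_right_mono) auto
  finally show ?thesis by (simp add: psi_square)
qed auto

section \<open>Reflections and fingerprints of Kunz tuples\<close>

text \<open>\<open>PiE\<close> fixes the values off \<open>{1..<m}\<close>, so that a tuple can be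
  counted as a function; the range \<open>{1..g}\<close> places all tuples in a finite box. Pairs
  with \<open>i + j = m\<close> carry no condition, as they land in the residue class 0.\<close>

definition kunz_tuples :: "nat \<Rightarrow> nat \<Rightarrow> (nat \<Rightarrow> nat) set" where
  "kunz_tuples m g = {k \<in> PiE {1..<m} (\<lambda>_. {1..g}). sum k {1..<m} = g \<and>
     (\<forall>i\<in>{1..<m}. \<forall>j\<in>{1..<m}. (i + j < m \<longrightarrow> k (i + j) \<le> k i + k j) \<and>
        (m < i + j \<longrightarrow> k (i + j - m) \<le> k i + k j + 1))}"

text \<open>The residue of \<open>c - i\<close> modulo \<open>m\<close>, taken in
  \<open>{1..<m}\<close>. The index \<open>i = c\<close> has no partner there: its value is
  \<open>m\<close>.\<close>

definition reflect :: "nat \<Rightarrow> nat \<Rightarrow> nat \<Rightarrow> nat" where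
  "reflect m c i = (if i < c then c - i else c + m - i)"

text \<open>A coordinate \<open>k c \<ge> M\<close> forces \<open>k i + k (reflect m c i) \<ge> req M c i\<close>; the case \<open>c \<le> i\<close> is the one
  where the indices wrap around \<open>m\<close>.\<close>

definition req :: "nat \<Rightarrow> nat \<Rightarrow> nat \<Rightarrow> nat" where
  "req M c i = (if i < c then M else M - 1)"

lemma reflect_mem:
  assumes "c \<in> {1..<m}" "i \<in> {1..<m} - {c}"
  shows "reflect m c i \<in> {1..<m} - {c}"
  using assms by (auto simp: reflect_def)

lemma reflect_reflect:
  assumes "c \<in> {1..<m}" "i \<in> {1..<m} - {c}"
  shows "reflect m c (reflect m c i) = i"
  using assms by (auto simp: reflect_def)

lemma reflect_less_iff:
  assumes "c \<in> {1..<m}" "i \<in> {1..<m} - {c}"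
  shows "reflect m c i < c \<longleftrightarrow> i < c"
  using assms by (auto simp: reflect_def)

lemma req_reflect:
  assumes "c \<in> {1..<m}" "i \<in> {1..<m} - {c}"
  shows "req M c (reflect m c i) = req M c i"
  using reflect_less_iff[OF assms] by (simp add: req_def)

text \<open>For fixed \<open>i\<close> the residue \<open>c - i\<close> modulo \<open>m\<close>
  determines \<open>c\<close>. In \<open>fingerprint\<close> this makes different centres act at
  different indices.\<close>

lemma reflect_inj:
  assumes "c \<in> {1..<m}" "c' \<in> {1..<m}" "i \<in> {1..<m}" "reflect m c i = reflect m c' i"
  shows "c = c'"
  using assms by (auto simp: reflect_def split: if_splits)

text \<open>An index and its reflection add up to \<open>c\<close> or \<open>c + m\<close>, so a
  defining inequality of the tuple bounds \<open>k c\<close>; its extra 1 in the second case is the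
  drop to \<open>M - 1\<close>.\<close>

lemma kunz_tuples_reflect:
  assumes k: "k \<in> kunz_tuples m g" and c: "c \<in> {1..<m}" and i: "i \<in> {1..<m} - {c}" and M: "M \<le> k c"
  shows "req M c i \<le> k i + k (reflect m c i)"
proof -
  have ri: "reflect m c i \<in> {1..<m}" using reflect_mem[OF c i] by simp
  have *: "(i + reflect m c i < m \<longrightarrow> k (i + reflect m c i) \<le> k i + k (reflect m c i)) \<and>
        (m < i + reflect m c i \<longrightarrow> k (i + reflect m c i - m) \<le> k i + k (reflect m c i) + 1)"
    using k i ri unfolding kunz_tuples_def by blast
  show ?thesis
  proof (cases "i < c")
    case True
    then have "i + reflect m c i = c" by (simp add: reflect_def)
    with * c M True show ?thesis by (simp add: req_def)
  next
    case False
    then have "i + reflect m c i = c + m" using i by (simp add: reflect_def)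
    with * c M False show ?thesis by (simp add: req_def)
  qed
qed

lemma kunz_tuples_mem:
  assumes "k \<in> kunz_tuples m g" "i \<in> {1..<m}"
  shows "1 \<le> k i" "k i \<le> g"
  using assms by (auto simp: kunz_tuples_def PiE_def Pi_def)

text \<open>The lower bound on coordinate \<open>i\<close> visible from \<open>\<tau>\<close>, the graph of the tuple restricted to a test set.\<close>

definition low :: "nat \<Rightarrow> nat \<Rightarrow> nat set \<Rightarrow> (nat \<times> nat) set \<Rightarrow> nat \<Rightarrow> nat" where
  "low m M C \<tau> i = Max (insert 1 {req M c i - v | c v. c \<in> C \<and> c \<noteq> i \<and> (reflect m c i, v) \<in> \<tau>})"

lemma low_finite: "finite {req M c i - v | c v. c \<in> C \<and> c \<noteq> i \<and> (reflect m c i, v) \<in> \<tau>}"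
  by (rule finite_subset[of _ "{..M}"]) (auto simp: req_def)

lemma low_ge_1: "1 \<le> low m M C \<tau> i"
  using low_finite by (simp add: low_def)

lemma low_le:
  assumes "1 \<le> b" "\<And>c v. c \<in> C \<Longrightarrow> c \<noteq> i \<Longrightarrow> (reflect m c i, v) \<in> \<tau> \<Longrightarrow> req M c i - v \<le> b"
  shows "low m M C \<tau> i \<le> b"
  unfolding low_def using low_finite assms by (subst Max_le_iff) auto

lemma low_ge:
  assumes "c \<in> C" "c \<noteq> i" "(reflect m c i, v) \<in> \<tau>"
  shows "req M c i - v \<le> low m M C \<tau> i"
  unfolding low_def using low_finite assms by (intro Max_ge) auto

lemma low_mono: "\<tau> \<subseteq> \<tau>' \<Longrightarrow> low m M C \<tau> i \<le> low m M C \<tau>' i"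
  by (intro low_le low_ge_1 low_ge) auto

text \<open>Soundness of \<open>low\<close>: a true value \<open>v\<close> recorded at the
  reflection leaves at least \<open>req M c i - v\<close> to coordinate \<open>i\<close>.\<close>

lemma low_le_value:
  assumes k: "k \<in> kunz_tuples m g" and C: "C \<subseteq> {1..<m}" "\<And>c. c \<in> C \<Longrightarrow> M \<le> k c"
    and i: "i \<in> {1..<m}" and \<tau>: "\<And>t v. (t, v) \<in> \<tau> \<Longrightarrow> k t = v"
  shows "low m M C \<tau> i \<le> k i"
proof (rule low_le)
  show "1 \<le> k i" using kunz_tuples_mem[OF k i] by simp
next
  fix c v assume c: "c \<in> C" "c \<noteq> i" and v: "(reflect m c i, v) \<in> \<tau>"
  have "req M c i \<le> k i + k (reflect m c i)"
    using c C i by (intro kunz_tuples_reflect[OF k]) auto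
  with \<tau>[OF v] show "req M c i - v \<le> k i" by simp
qed

text \<open>A test set that maximises the sum of the lower bounds it forces, minus a penalty
  \<^term>\<open>d\<close> per element, leaves few pairs whose constraint is not already visible.\<close>

lemma fingerprint:
  assumes C: "C \<subseteq> {1..<m}" "C \<noteq> {}" and M: "M \<le> B" "1 \<le> B"
    and k1: "\<And>i. i \<in> {1..<m} \<Longrightarrow> 1 \<le> k i"
  obtains \<tau> c where "\<tau> \<subseteq> {1..<m} \<times> {1..<B}" "\<forall>(t, v)\<in>\<tau>. k t = v"
    "d * card \<tau> \<le> B * (m - 1)" "c \<in> C"
    "card C * card {j \<in> {1..<m} - {c}. low m M C \<tau> (reflect m c j) < req M c j - k j} \<le> d * (m - 1)"
proof -
  \<comment> \<open>Since \<open>req M c i\<close> never exceeds \<open>B\<close>, a coordinate of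
    size \<open>B\<close> or more satisfies its constraints alone. Only smaller ones are tested, and
    their values fit into \<open>{1..<B}\<close>.\<close>
  define J where "J = {i \<in> {1..<m}. k i < B}"
  define pt where "pt T = (\<lambda>t. (t, k t)) ` T" for T
  define \<Phi> where "\<Phi> T = (\<Sum>i\<in>{1..<m}. int (low m M C (pt T) i)) - int d * int (card T)" for T
  have finC: "finite C" using C by (auto intro: finite_subset)
  have finJ: "finite J" by (simp add: J_def)
  have ex: "\<exists>T\<in>Pow J. \<forall>T'\<in>Pow J. \<Phi> T' \<le> \<Phi> T"
  proof -
    have "finite (\<Phi> ` Pow J)" "\<Phi> ` Pow J \<noteq> {}" using finJ by auto
    then have "Max (\<Phi> ` Pow J) \<in> \<Phi> ` Pow J" "\<forall>x\<in>\<Phi> ` Pow J. x \<le> Max (\<Phi> ` Pow J)" by auto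
    then show ?thesis by (metis imageE imageI)
  qed
  then obtain T where T: "T \<subseteq> J" and max: "\<And>T'. T' \<subseteq> J \<Longrightarrow> \<Phi> T' \<le> \<Phi> T" by auto
  have finT: "finite T" using T finJ finite_subset by blast
  have card_pt: "card (pt T) = card T"
    unfolding pt_def by (rule card_image) (auto simp: inj_on_def)
  have pt_sub: "pt T \<subseteq> {1..<m} \<times> {1..<B}" using T k1 by (auto simp: pt_def J_def)
  have low_B: "low m M C (pt T) i \<le> B" for i
    using M by (intro low_le) (auto simp: req_def)
  \<comment> \<open>The empty test set scores at least 0 and the bounds total at most
    \<open>B * (m - 1)\<close>, so the penalty limits the size of the optimal
    \<open>T\<close>.\<close>
  have "\<Phi> {} \<le> \<Phi> T" by (rule max) simp
  moreover have "0 \<le> \<Phi> {}" by (simp add: \<Phi>_def sum_nonneg)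
  moreover have "(\<Sum>i\<in>{1..<m}. int (low m M C (pt T) i)) \<le> (\<Sum>i\<in>{1..<m}. int B)"
    using low_B by (intro sum_mono) simp
  ultimately have "int d * int (card T) \<le> int B * int (m - 1)"
    by (simp add: \<Phi>_def mult.commute)
  then have dT: "d * card (pt T) \<le> B * (m - 1)"
    by (simp only: card_pt of_nat_mult[symmetric] of_nat_le_iff)
  define bad where "bad c j \<longleftrightarrow> c \<noteq> j \<and> low m M C (pt T) (reflect m c j) < req M c j - k j" for c j
  \<comment> \<open>If \<open>j\<close> were bad for more than \<open>d\<close> centres, adding it
    to \<open>T\<close> would raise the bounds at that many different indices by at least 1 each.
    This exceeds the penalty \<open>d\<close> and contradicts the maximality of
    \<open>T\<close>.\<close>
  have few: "card {c \<in> C. bad c j} \<le> d" if j: "j \<in> {1..<m}" for j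
  proof (rule ccontr)
    assume asm: "\<not> card {c \<in> C. bad c j} \<le> d"
    define R where "R = (\<lambda>c. reflect m c j) ` {c \<in> C. bad c j}"
    have R_inj: "inj_on (\<lambda>c. reflect m c j) {c \<in> C. bad c j}"
    proof (rule inj_onI)
      fix c c' assume *: "c \<in> {c \<in> C. bad c j}" "c' \<in> {c \<in> C. bad c j}" "reflect m c j = reflect m c' j"
      then have "c \<in> {1..<m}" "c' \<in> {1..<m}" using C by auto
      then show "c = c'" using j *(3) by (rule reflect_inj)
    qed
    have cardR: "card R = card {c \<in> C. bad c j}" unfolding R_def by (rule card_image[OF R_inj])
    have R_sub: "R \<subseteq> {1..<m}"
      using C j reflect_mem[of _ m j] by (force simp: R_def bad_def)
    have inc: "low m M C (pt T) i + 1 \<le> low m M C (pt (insert j T)) i" if "i \<in> R" for i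
    proof -
      from that obtain c where c: "c \<in> C" "bad c j" and ieq: "i = reflect m c j" by (auto simp: R_def)
      have cj: "c \<in> {1..<m}" "j \<in> {1..<m} - {c}" using c C j by (auto simp: bad_def)
      have "req M c i - k j \<le> low m M C (pt (insert j T)) i"
      proof (rule low_ge[OF c(1)])
        show "c \<noteq> i" using reflect_mem[OF cj] ieq by auto
        show "(reflect m c i, k j) \<in> pt (insert j T)" using reflect_reflect[OF cj] ieq by (auto simp: pt_def)
      qed
      then show ?thesis using c(2) req_reflect[OF cj] ieq by (simp add: bad_def)
    qed
    have nR: "R \<noteq> {}" using asm cardR by auto
    have jT: "j \<notin> T"
    proof
      assume "j \<in> T"
      then have "insert j T = T" by auto
      with inc nR show False by fastforce
    qed
    have jJ: "j \<in> J"
    proof -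
      obtain i where "i \<in> R" using nR by auto
      then obtain c where "bad c j" by (auto simp: R_def)
      then have "k j < req M c j" unfolding bad_def by linarith
      also have "\<dots> \<le> B" using M by (auto simp: req_def)
      finally show ?thesis using j by (simp add: J_def)
    qed
    have "\<Phi> (insert j T) \<le> \<Phi> T" using T jJ by (intro max) auto
    moreover have "(\<Sum>i\<in>{1..<m}. int (low m M C (pt T) i)) + int (card R)
        \<le> (\<Sum>i\<in>{1..<m}. int (low m M C (pt (insert j T)) i))"
    proof -
      have "(\<Sum>i\<in>{1..<m}. int (low m M C (pt T) i)) + int (card R)
          = (\<Sum>i\<in>{1..<m}. int (low m M C (pt T) i) + (if i \<in> R then 1 else 0))"
      proof -
        have "{1..<m} \<inter> {i. i \<in> R} = R" using R_sub by auto
        then show ?thesis by (simp add: sum.distrib sum.If_cases)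
      qed
      also have "\<dots> \<le> (\<Sum>i\<in>{1..<m}. int (low m M C (pt (insert j T)) i))"
      proof (rule sum_mono)
        fix i
        have "low m M C (pt T) i \<le> low m M C (pt (insert j T)) i"
          by (rule low_mono) (auto simp: pt_def)
        then show "int (low m M C (pt T) i) + (if i \<in> R then 1 else 0) \<le> int (low m M C (pt (insert j T)) i)"
          using inc[of i] by auto
      qed
      finally show ?thesis .
    qed
    moreover have "card (insert j T) = card T + 1" using jT finT by simp
    ultimately have "int (card R) \<le> int d" by (simp add: \<Phi>_def algebra_simps)
    with asm cardR show False by simp
  qed
  \<comment> \<open>Double counting of the bad pairs, then averaging over \<open>C\<close>, yields a
    centre with few bad indices.\<close>
  have "(\<Sum>c\<in>C. card {j \<in> {1..<m}. bad c j}) = (\<Sum>j\<in>{1..<m}. card {c \<in> C. bad c j})"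
  proof -
    have "(\<Sum>c\<in>C. card {j \<in> {1..<m}. bad c j}) = (\<Sum>c\<in>C. \<Sum>j\<in>{1..<m}. if bad c j then 1 else 0)"
      by (simp only: card_eq_sum sum.inter_filter finite_atLeastLessThan)
    also have "\<dots> = (\<Sum>j\<in>{1..<m}. \<Sum>c\<in>C. if bad c j then 1 else 0)" by (rule sum.swap)
    also have "\<dots> = (\<Sum>j\<in>{1..<m}. card {c \<in> C. bad c j})"
      using finC by (simp only: card_eq_sum sum.inter_filter)
    finally show ?thesis .
  qed
  also have "\<dots> \<le> (\<Sum>j\<in>{1..<m}. d)" using few by (intro sum_mono) auto
  finally have tot: "(\<Sum>c\<in>C. card {j \<in> {1..<m}. bad c j}) \<le> d * (m - 1)" by (simp add: mult.commute)
  have "\<exists>c\<in>C. card C * card {j \<in> {1..<m}. bad c j} \<le> d * (m - 1)"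
  proof (rule ccontr)
    assume "\<not> ?thesis"
    then have "\<And>c. c \<in> C \<Longrightarrow> d * (m - 1) < card C * card {j \<in> {1..<m}. bad c j}" by (auto simp: not_le)
    then have "(\<Sum>c\<in>C. d * (m - 1)) < (\<Sum>c\<in>C. card C * card {j \<in> {1..<m}. bad c j})"
      using finC C by (intro sum_strict_mono) auto
    also have "\<dots> = card C * (\<Sum>c\<in>C. card {j \<in> {1..<m}. bad c j})" by (rule sum_distrib_left[symmetric])
    also have "\<dots> \<le> card C * (d * (m - 1))" using tot by (rule mult_le_mono2)
    finally show False by simp
  qed
  then obtain c where c: "c \<in> C" "card C * card {j \<in> {1..<m}. bad c j} \<le> d * (m - 1)" by auto
  have "{j \<in> {1..<m} - {c}. low m M C (pt T) (reflect m c j) < req M c j - k j} = {j \<in> {1..<m}. bad c j}"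
    by (auto simp: bad_def)
  with c(2) have "card C * card {j \<in> {1..<m} - {c}. low m M C (pt T) (reflect m c j) < req M c j - k j}
      \<le> d * (m - 1)" by simp
  then show thesis
    by (intro that[OF pt_sub _ dT c(1)]) (auto simp: pt_def)
qed

section \<open>Containers for tuples with many large coordinates\<close>

text \<open>Threshold 3 concerns only the indices from \<open>\<epsilon> * real m\<close> on: at
  level 3 the wrapped indices get requirement 2, which saves no weight, so a centre \<open>c\<close>
  gains only from the indices below it and must itself be large.\<close>

definition tame :: "nat \<Rightarrow> real \<Rightarrow> nat \<Rightarrow> (nat \<Rightarrow> nat) \<Rightarrow> bool" where
  "tame K \<epsilon> m k \<longleftrightarrow> card {i \<in> {1..<m}. 4 \<le> k i} < K \<and>
     card {i \<in> {1..<m}. \<epsilon> * real m \<le> real i \<and> 3 \<le> k i} < K"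

text \<open>\<open>C\<close> is taken from the top of \<open>P\<close>: the cut is the last point
  with at least \<open>K\<close> elements of \<open>P\<close> on or above it.\<close>

lemma top_subset:
  fixes P :: "nat set"
  assumes "finite P" "1 \<le> K" "K \<le> card P"
  obtains C where "C \<subseteq> P" "card C = K" "\<And>c. c \<in> C \<Longrightarrow> card {i \<in> P. c < i} < K"
proof -
  define A where "A = {c. K \<le> card (P \<inter> {c..})}"
  have "A \<subseteq> {..Max P}"
  proof
    fix c assume "c \<in> A"
    then have "P \<inter> {c..} \<noteq> {}" using assms(2) by (auto simp: A_def)
    then obtain p where "p \<in> P" "c \<le> p" by auto
    then show "c \<in> {..Max P}" using Max_ge[OF assms(1)] by force
  qed
  then have finA: "finite A" by (rule finite_subset) simp
  have "0 \<in> A" using assms(3) by (simp add: A_def)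
  then have "Max A \<in> A" using finA by (intro Max_in) auto
  then obtain C where C: "C \<subseteq> P \<inter> {Max A..}" "card C = K"
    unfolding A_def by (metis (no_types, lifting) mem_Collect_eq obtain_subset_with_card_n)
  have "Suc (Max A) \<notin> A" using Max_ge[OF finA] by force
  then have lt: "card (P \<inter> {Suc (Max A)..}) < K" by (simp add: A_def not_le)
  show thesis
  proof (rule that[of C])
    fix c assume "c \<in> C"
    then have "{i \<in> P. c < i} \<subseteq> P \<inter> {Suc (Max A)..}" using C by auto
    then show "card {i \<in> P. c < i} < K"
      using lt assms(1) by (meson card_mono finite_Int le_less_trans)
  qed (use C in auto)
qed

text \<open>The level is the highest of 3, 4, 5 that is reached \<open>K\<close> times, with 3
  counted only on the far indices. Below the centre, exceeding the requirement means reaching the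
  next level, which is rare (at level 5 no cap applies there). Above the centre the requirement is
  one lower, so exceeding it only means reaching \<open>M\<close>; taking the centres from the top
  keeps those indices few.\<close>

lemma not_tame_levels:
  assumes "\<not> tame K \<epsilon> m k" "1 \<le> K"
  obtains M C where "M \<in> {3..6}" "C \<subseteq> {1..<m}" "card C = K" "\<forall>c\<in>C. M \<le> k c"
    "\<forall>c\<in>C. M = 3 \<longrightarrow> \<epsilon> * real m \<le> real c"
    "\<forall>c\<in>C. card {i \<in> {1..<m} - {c}. req M c i \<le> 4 \<and> req M c i < k i} \<le> 2 * K"
proof -
  define P where "P M = {i \<in> {1..<m}. M \<le> k i \<and> (M = 3 \<longrightarrow> \<epsilon> * real m \<le> real i)}" for M
  have finP: "finite (P M)" for M by (simp add: P_def)
  have "\<exists>M\<in>{3..6}. K \<le> card (P M) \<and> (M \<le> 4 \<longrightarrow> card (P (M + 1)) < K)"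
  proof (cases "K \<le> card (P 4)")
    case True
    show ?thesis
    proof (cases "K \<le> card (P 5)")
      case True then show ?thesis by (intro bexI[of _ 5]) auto
    next
      case False with \<open>K \<le> card (P 4)\<close> show ?thesis by (intro bexI[of _ 4]) auto
    qed
  next
    case False
    then have "K \<le> card (P 3)" using assms(1)
      by (auto simp: tame_def P_def not_less conj_commute)
    with False show ?thesis by (intro bexI[of _ 3]) auto
  qed
  then obtain M where M: "M \<in> {3..6}" "K \<le> card (P M)" "M \<le> 4 \<longrightarrow> card (P (M + 1)) < K" by blast
  obtain C where C: "C \<subseteq> P M" "card C = K" "\<And>c. c \<in> C \<Longrightarrow> card {i \<in> P M. c < i} < K"
    using top_subset[OF finP assms(2) M(2)] by metis
  show thesis
  proof (rule that[OF M(1) _ C(2)])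
    show "\<forall>c\<in>C. card {i \<in> {1..<m} - {c}. req M c i \<le> 4 \<and> req M c i < k i} \<le> 2 * K"
    proof
      fix c assume c: "c \<in> C"
      have "{i \<in> {1..<m} - {c}. req M c i \<le> 4 \<and> req M c i < k i}
          \<subseteq> (if M \<le> 4 then P (M + 1) else {}) \<union> {i \<in> P M. c < i}" (is "?L \<subseteq> ?A \<union> ?B")
      proof
        fix i assume i: "i \<in> ?L"
        then have iI: "i \<in> {1..<m}" "i \<noteq> c" by auto
        show "i \<in> ?A \<union> ?B"
        proof (cases "i < c")
          case True
          with i have "M \<le> 4" "M < k i" by (auto simp: req_def)
          with iI M(1) show ?thesis by (simp add: P_def)
        next
          case False
          with i iI have "c < i" "M \<le> k i" by (auto simp: req_def)
          moreover have "\<epsilon> * m \<le> i" if "M = 3"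
          proof -
            have "\<epsilon> * m \<le> c" using c C(1) that by (auto simp: P_def)
            with \<open>c < i\<close> show ?thesis by linarith
          qed
          ultimately show ?thesis using iI by (simp add: P_def)
        qed
      qed
      then have "card ?L \<le> card (?A \<union> ?B)" by (intro card_mono) (auto simp: finP)
      also have "\<dots> \<le> card ?A + card ?B" by (rule card_Un_le)
      also have "\<dots> \<le> K + K" using M(3) C(3)[OF c] by (intro add_mono) auto
      finally show "card ?L \<le> 2 * K" by simp
    qed
  qed (use C(1) in \<open>auto simp: P_def\<close>)
qed

section \<open>Weights of reflected pairs and of certificates\<close>

text \<open>For \<open>r\<close> above 4 the geometric tails alone give
  \<open>psi ^ (r - 4)\<close>, at most \<open>psi\<close>. For smaller \<open>r\<close> they would
  save nothing, hence the cap \<open>U = r\<close>, which leaves finitely many cases. The constant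
  is attained: \<open>r = 3\<close> with lower bounds 1 and 2 gives exactly
  \<open>1 - psi ^ 3\<close>.\<close>

lemma pair_weight:
  fixes g :: nat
  assumes "1 \<le> L" "1 \<le> L'" "r \<le> L + L'" "2 \<le> r"
    and U: "U = (if r \<le> 4 then r else g)"
  shows "(\<Sum>v=L..U. psi ^ v) * (\<Sum>v=L'..U. psi ^ v) \<le> (if 3 \<le> r then 1 - psi ^ 3 else 1)"
proof (cases "r \<le> 4")
  case False
  have p3: "psi ^ 3 = 2 * psi - 1" by (simp add: power3_eq_cube psi_mult algebra_simps)
  have "(\<Sum>v=L..U. psi ^ v) * (\<Sum>v=L'..U. psi ^ v) \<le> (psi ^ L / psi ^ 2) * (psi ^ L' / psi ^ 2)"
    by (intro mult_mono sum_psi_power_le sum_nonneg) auto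
  also have "\<dots> = psi ^ (L + L') / psi ^ 4" by (simp add: power_add eval_nat_numeral)
  also have "\<dots> \<le> psi ^ 5 / psi ^ 4"
    using False assms by (intro divide_right_mono power_decreasing) auto
  also have "\<dots> = psi" by (simp add: eval_nat_numeral)
  also have "\<dots> \<le> 1 - psi ^ 3" using psi_bounds by (simp add: p3)
  finally show ?thesis using False by simp
next
  case True
  have U: "U = r" using True U by simp
  \<comment> \<open>Reduces powers of \<open>psi\<close> to linear terms, so that the numerical
    bounds on \<open>psi\<close> can settle the cases.\<close>
  have p2: "psi * (psi * x) = x - psi * x" for x
    by (simp add: psi_mult algebra_simps flip: mult.assoc)
  show ?thesis
  proof (cases "L \<le> r \<and> L' \<le> r")
    case False
    then have z: "(\<Sum>v=L..U. psi ^ v) * (\<Sum>v=L'..U. psi ^ v) = 0" by (auto simp: U)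
    show ?thesis unfolding z by (simp add: power_le_one)
  next
    case le: True
    have "r \<in> {2,3,4}" "L \<in> {1,2,3,4}" "L' \<in> {1,2,3,4}" using True le assms by auto
    then show ?thesis using assms(3) le psi_bounds unfolding U
      by (auto simp: numeral_eq_Suc sum.atLeast_Suc_atMost psi_mult p2 algebra_simps)
  qed
qed

text \<open>Outside an exceptional set \<open>Z\<close> and its reflection, the range of coordinate \<open>i\<close> is cut off below so
  that the bounds at \<open>i\<close> and at its reflection add up to at least \<open>req M c i\<close>. A cap from above is only
  needed when this number is at most \<open>4\<close>.\<close>

definition cert_range :: "nat \<Rightarrow> nat \<Rightarrow> nat \<Rightarrow> nat \<Rightarrow> nat set \<Rightarrow> nat set \<Rightarrow> (nat \<times> nat) set \<Rightarrow> nat \<Rightarrow> nat set"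
  where "cert_range m g M c C Z \<tau> i =
    (if i = c \<or> i \<in> Z \<or> reflect m c i \<in> Z then {1..g}
     else {max (low m M C \<tau> i) (req M c i - low m M C \<tau> (reflect m c i))..
           (if req M c i \<le> 4 then req M c i else g)})"

text \<open>\<open>Z\<close> joins the indices whose constraint the fingerprint misses
  (\<open>Z1\<close>) with those that exceed the cap (\<open>Z2\<close>). The bound 6 on recorded
  values dominates every level \<open>M\<close>.\<close>

lemma cert_exists:
  assumes k: "k \<in> kunz_tuples m g" and nt: "\<not> tame K \<epsilon> m k" and K: "1 \<le> K"
  obtains M c C Z \<tau> where "M \<in> {3..6}" "c \<in> {1..<m}" "M = 3 \<Longrightarrow> \<epsilon> * real m \<le> real c"
    "C \<subseteq> {1..<m}" "card C \<le> K" "Z \<subseteq> {1..<m}" "card Z \<le> d * (m - 1) div K + 2 * K"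
    "\<tau> \<subseteq> {1..<m} \<times> {1..<6}" "d * card \<tau> \<le> 6 * (m - 1)"
    "k \<in> PiE {1..<m} (cert_range m g M c C Z \<tau>)"
proof -
  obtain M C where M: "M \<in> {3..6}" and C: "C \<subseteq> {1..<m}" "card C = K" "\<forall>c\<in>C. M \<le> k c"
    and C3: "\<forall>c\<in>C. M = 3 \<longrightarrow> \<epsilon> * real m \<le> real c"
    and Ex: "\<forall>c\<in>C. card {i \<in> {1..<m} - {c}. req M c i \<le> 4 \<and> req M c i < k i} \<le> 2 * K"
    by (rule not_tame_levels[OF nt K])
  have "C \<noteq> {}" using C(2) K by auto
  have M6: "M \<le> 6" using M by simp
  obtain \<tau> c where \<tau>: "\<tau> \<subseteq> {1..<m} \<times> {1..<6}" "\<forall>(t, v)\<in>\<tau>. k t = v"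
      "d * card \<tau> \<le> 6 * (m - 1)" and c: "c \<in> C"
    and bad: "card C * card {j \<in> {1..<m} - {c}. low m M C \<tau> (reflect m c j) < req M c j - k j} \<le> d * (m - 1)"
    by (rule fingerprint[OF C(1) \<open>C \<noteq> {}\<close> M6 one_le_numeral kunz_tuples_mem(1)[OF k], where d = d])
  define Z1 where "Z1 = {j \<in> {1..<m} - {c}. low m M C \<tau> (reflect m c j) < req M c j - k j}"
  define Z2 where "Z2 = {i \<in> {1..<m} - {c}. req M c i \<le> 4 \<and> req M c i < k i}"
  have "card Z1 \<le> d * (m - 1) div K"
    using bad C(2) K by (simp add: Z1_def less_eq_div_iff_mult_less_eq mult.commute)
  then have cardZ: "card (Z1 \<union> Z2) \<le> d * (m - 1) div K + 2 * K"
    using bspec[OF Ex c] card_Un_le[of Z1 Z2] by (simp add: Z2_def)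
  have cI: "c \<in> {1..<m}" using c C(1) by auto
  have "k i \<in> cert_range m g M c C (Z1 \<union> Z2) \<tau> i" if i: "i \<in> {1..<m}" for i
  proof -
    have "low m M C \<tau> i \<le> k i"
      by (rule low_le_value[OF k C(1) _ i]) (use C(3) \<tau>(2) in auto)
    then show ?thesis using kunz_tuples_mem[OF k i] i
      by (auto simp: cert_range_def Z1_def Z2_def)
  qed
  moreover have "k \<in> extensional {1..<m}" using k by (auto simp: kunz_tuples_def PiE_def)
  ultimately have "k \<in> PiE {1..<m} (cert_range m g M c C (Z1 \<union> Z2) \<tau>)" by (auto simp: PiE_def)
  then show thesis
    by (intro that[OF M cI bspec[OF C3 c, rule_format] C(1) _ _ cardZ \<tau>(1) \<tau>(3)]) (use C(2) in \<open>auto simp: Z1_def Z2_def\<close>)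
qed

text \<open>Only the centre, \<open>Z\<close> and its reflection escape; each such index costs at
  most a factor \<open>exp 1\<close>. The others come in reflected pairs, and \<open>a\<close>
  contains a square root because two indices share the saving of a pair. The term
  \<open>4 * card Z + 3\<close> bounds \<open>2 * card X + 1\<close>, which collects this cost and
  the savings missed on \<open>X\<close>.\<close>

lemma cert_count:
  fixes a \<epsilon> :: real
  assumes c: "c \<in> {1..<m}" and M: "M \<in> {3..6}" and Z: "Z \<subseteq> {1..<m}"
    and M3: "M = 3 \<Longrightarrow> \<epsilon> * real m \<le> real c" and \<epsilon>: "0 \<le> \<epsilon>" "\<epsilon> \<le> 1"
  defines "a \<equiv> - ln (sqrt (1 - psi ^ 3))"
  shows "real (card {k \<in> PiE {1..<m} (cert_range m g M c C Z \<tau>). sum k {1..<m} = g}) * psi ^ g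
    \<le> exp (4 * card Z + 3 - a * \<epsilon> * m)"
proof -
  let ?I = "{1..<m}" and ?V = "cert_range m g M c C Z \<tau>" and ?\<sigma> = "reflect m c" and ?q = "1 - psi ^ 3"
  define u where "u i = (\<Sum>v\<in>?V i. psi ^ v)" for i
  define X where "X = {i \<in> ?I. i = c \<or> i \<in> Z \<or> ?\<sigma> i \<in> Z}"
  have p3: "psi ^ 3 = 2 * psi - 1" by (simp add: power3_eq_cube psi_mult algebra_simps)
  have q: "0.7 < ?q" "?q < 1" using psi_bounds by (simp_all add: p3)
  have finZ: "finite Z" using Z finite_subset by blast
  have X: "X \<subseteq> ?I" by (auto simp: X_def)
  have finX: "finite X" using X finite_subset by blast
  have cardX: "card X \<le> 2 * card Z + 1"
  proof -
    have "X \<subseteq> insert c (Z \<union> ?\<sigma> ` Z)"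
    proof
      fix i assume i: "i \<in> X"
      show "i \<in> insert c (Z \<union> ?\<sigma> ` Z)"
      proof (cases "i = c \<or> i \<in> Z")
        case False
        with i have "?\<sigma> i \<in> Z" "i \<in> ?I - {c}" by (auto simp: X_def)
        then have "?\<sigma> (?\<sigma> i) \<in> ?\<sigma> ` Z" by blast
        then show ?thesis using reflect_reflect[OF c \<open>i \<in> ?I - {c}\<close>] by simp
      qed auto
    qed
    then have "card X \<le> card (insert c (Z \<union> ?\<sigma> ` Z))" using finZ by (intro card_mono) auto
    also have "\<dots> \<le> Suc (card (Z \<union> ?\<sigma> ` Z))" by (rule card_insert_le_m1) auto
    also have "\<dots> \<le> Suc (card Z + card (?\<sigma> ` Z))" using card_Un_le[of Z "?\<sigma> ` Z"] by simp
    also have "\<dots> \<le> 2 * card Z + 1" using card_image_le[OF finZ, of ?\<sigma>] by simp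
    finally show ?thesis .
  qed
  have finV: "finite (?V i)" for i by (simp add: cert_range_def)
  have u0: "0 \<le> u i" for i by (auto simp: u_def intro!: sum_nonneg)
  have "real (card {k \<in> PiE ?I ?V. sum k ?I = g}) * psi ^ g \<le> (\<Prod>i\<in>?I. u i)"
    unfolding u_def by (rule card_PiE_weighted_le) (auto simp: finV power_sum)
  also have "\<dots> = (\<Prod>i\<in>X. u i) * (\<Prod>i\<in>?I - X. u i)"
    using prod.subset_diff[OF X, of u] by (simp add: mult.commute)
  also have "\<dots> \<le> exp (card X) * exp (- a * card {i \<in> ?I - X. 3 \<le> req M c i})"
  proof (rule mult_mono)
    have "(\<Prod>i\<in>X. u i) \<le> (\<Prod>i\<in>X. exp 1)"
    proof (rule prod_mono)
      fix i assume i: "i \<in> X"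
      then have "u i = (\<Sum>v=1..g. psi ^ v)" by (auto simp: u_def X_def cert_range_def)
      also have "\<dots> \<le> psi ^ 1 / psi ^ 2" by (rule sum_psi_power_le)
      also have "\<dots> = 1 / psi" by (simp add: power2_eq_square)
      also have "\<dots> \<le> 2" using psi_bounds by (simp add: field_simps)
      also have "\<dots> \<le> exp 1" using exp_ge_add_one_self[of 1] by simp
      finally show "0 \<le> u i \<and> u i \<le> exp 1" using u0 by simp
    qed
    then show "(\<Prod>i\<in>X. u i) \<le> exp (card X)" using exp_of_nat_mult[of "card X" "1::real"] by simp
  next
    have \<sigma>X: "?\<sigma> i \<in> ?I - X" if "i \<in> ?I - X" for i
      using that reflect_mem[OF c, of i] reflect_reflect[OF c, of i] by (auto simp: X_def)
    have bij: "bij_betw ?\<sigma> (?I - X) (?I - X)"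
    proof (rule bij_betwI[where g = ?\<sigma>])
      fix i assume "i \<in> ?I - X"
      then show "?\<sigma> (?\<sigma> i) = i" by (intro reflect_reflect[OF c]) (use c in \<open>auto simp: X_def\<close>)
      then show "?\<sigma> (?\<sigma> i) = i" .
    qed (use \<sigma>X in auto)
    \<comment> \<open>Squaring pairs every index with its reflection without choosing
      representatives, and treats fixed points of the reflection in the same way.\<close>
    have "(\<Prod>i\<in>?I - X. u i)\<^sup>2 = (\<Prod>i\<in>?I - X. u i) * (\<Prod>i\<in>?I - X. u (?\<sigma> i))"
      by (simp only: power2_eq_square prod.reindex_bij_betw[OF bij, of u])
    also have "\<dots> = (\<Prod>i\<in>?I - X. u i * u (?\<sigma> i))" by (rule prod.distrib[symmetric])
    also have "\<dots> \<le> (\<Prod>i\<in>?I - X. if 3 \<le> req M c i then ?q else 1)"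
    proof (rule prod_mono, intro conjI)
      fix i assume i: "i \<in> ?I - X"
      show "0 \<le> u i * u (?\<sigma> i)" using u0 by simp
      have ic: "i \<in> ?I - {c}" using i by (auto simp: X_def)
      define l where "l = low m M C \<tau> i"
      define l' where "l' = low m M C \<tau> (?\<sigma> i)"
      have ui: "u i = (\<Sum>v=max l (req M c i - l')..(if req M c i \<le> 4 then req M c i else g). psi ^ v)"
        using i by (auto simp: u_def X_def cert_range_def l_def l'_def)
      have uj: "u (?\<sigma> i) = (\<Sum>v=max l' (req M c i - l)..(if req M c i \<le> 4 then req M c i else g). psi ^ v)"
        using i \<sigma>X[OF i] reflect_reflect[OF c ic] req_reflect[OF c ic]
        by (auto simp: u_def X_def cert_range_def l_def l'_def)
      have "1 \<le> l" "1 \<le> l'" unfolding l_def l'_def by (rule low_ge_1)+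
      moreover have "2 \<le> req M c i" using M by (auto simp: req_def)
      ultimately show "u i * u (?\<sigma> i) \<le> (if 3 \<le> req M c i then ?q else 1)"
        unfolding ui uj by (intro pair_weight[where g = g]) auto
    qed
    also have "\<dots> = ?q ^ card {i \<in> ?I - X. 3 \<le> req M c i}"
      by (simp add: prod.If_cases Int_def)
    also have "\<dots> = (sqrt ?q ^ card {i \<in> ?I - X. 3 \<le> req M c i})\<^sup>2"
      using q by (simp add: power2_eq_square flip: power_mult_distrib)
    finally have "(\<Prod>i\<in>?I - X. u i) \<le> sqrt ?q ^ card {i \<in> ?I - X. 3 \<le> req M c i}"
      by (rule power2_le_imp_le) (use q in auto)
    also have "\<dots> = exp (- a) ^ card {i \<in> ?I - X. 3 \<le> req M c i}"
      using q by (simp add: a_def)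
    finally show "(\<Prod>i\<in>?I - X. u i) \<le> exp (- a * card {i \<in> ?I - X. 3 \<le> req M c i})"
      by (metis exp_of_nat2_mult)
  qed (auto intro!: prod_nonneg u0)
  also have "\<dots> \<le> exp (4 * card Z + 3 - a * \<epsilon> * m)"
  proof -
    have a: "0 < a" "a \<le> 1"
    proof -
      show "0 < a" using q by (simp add: a_def ln_sqrt)
      have "exp (-1) \<le> (1/2 :: real)" using exp_ge_add_one_self[of 1] by (simp add: exp_minus field_simps)
      also have "\<dots> \<le> sqrt ?q" by (rule real_le_rsqrt) (use q in \<open>simp add: power2_eq_square\<close>)
      finally show "a \<le> 1" using q by (simp add: a_def ln_ge_iff flip: minus_le_iff)
    qed
    have "{i \<in> ?I. 3 \<le> req M c i} \<subseteq> {i \<in> ?I - X. 3 \<le> req M c i} \<union> X" by auto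
    then have "card {i \<in> ?I. 3 \<le> req M c i} \<le> card ({i \<in> ?I - X. 3 \<le> req M c i} \<union> X)"
      using finX by (intro card_mono) auto
    also have "\<dots> \<le> card {i \<in> ?I - X. 3 \<le> req M c i} + card X" by (rule card_Un_le)
    finally have n1: "card {i \<in> ?I. 3 \<le> req M c i} \<le> card {i \<in> ?I - X. 3 \<le> req M c i} + card X" .
    \<comment> \<open>At level 3 the indices below \<open>c\<close> have requirement 3, and there
      are at least \<open>\<epsilon> * m - 1\<close> of them; at higher levels every index
      qualifies.\<close>
    have n2: "\<epsilon> * m - 1 \<le> card {i \<in> ?I. 3 \<le> req M c i}"
    proof (cases "M = 3")
      case True
      have "{1..<c} \<subseteq> {i \<in> ?I. 3 \<le> req M c i}" using c True by (auto simp: req_def)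
      then have "card {1..<c} \<le> card {i \<in> ?I. 3 \<le> req M c i}" by (intro card_mono) auto
      then show ?thesis using M3[OF True] c by simp
    next
      case False
      then have "{i \<in> ?I. 3 \<le> req M c i} = ?I" using M by (auto simp: req_def)
      moreover have "\<epsilon> * m \<le> 1 * real m" using \<epsilon> by (intro mult_right_mono) auto
      ultimately show ?thesis by simp
    qed
    have "a * (\<epsilon> * m - 1 - card X) \<le> a * card {i \<in> ?I - X. 3 \<le> req M c i}"
      using n1 n2 a by (intro mult_left_mono) auto
    moreover have "a * (1 + real (card X)) \<le> 1 * (1 + real (card X))" using a by (intro mult_right_mono) auto
    moreover have "real (card X) \<le> 2 * card Z + 1" using cardX by linarith
    ultimately have "card X + - a * card {i \<in> ?I - X. 3 \<le> req M c i} \<le> 4 * card Z + 3 - a * \<epsilon> * m"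
      by (simp add: algebra_simps)
    then show ?thesis by (simp flip: exp_add)
  qed
  finally show ?thesis .
qed

lemma real_nat_div_le: "real (x div y) \<le> real x / real y"
proof (cases "y = 0")
  case False
  have "real (x div y * y) \<le> real x" by (simp only: of_nat_le_iff div_times_less_eq_dividend)
  then show ?thesis using False by (simp add: field_simps)
qed simp

lemma finite_kunz_tuples: "finite (kunz_tuples m g)"
  by (rule finite_subset[of _ "PiE {1..<m} (\<lambda>_. {1..g})"]) (auto simp: kunz_tuples_def intro!: finite_PiE)

lemma eventually_linear_less_exp:
  assumes "0 < (b::real)"
  shows "eventually (\<lambda>m. c * real m \<le> exp (b * real m)) sequentially"
proof -
  obtain n0 where n0: "real n0 \<ge> 2 * \<bar>c\<bar> / b\<^sup>2" using real_arch_simple by blast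
  show ?thesis
  proof (rule eventually_sequentiallyI)
    fix m assume "n0 \<le> m"
    then have "2 * \<bar>c\<bar> / b\<^sup>2 \<le> real m" using n0 by linarith
    then have "\<bar>c\<bar> \<le> real m * b\<^sup>2 / 2" using assms by (simp add: field_simps)
    then have "\<bar>c\<bar> * m \<le> (real m * b\<^sup>2 / 2) * m" by (rule mult_right_mono) simp
    also have "\<dots> = (b * m)\<^sup>2 / 2" by (simp add: power2_eq_square)
    also have "\<dots> \<le> exp (b * m)"
      using exp_lower_Taylor_quadratic[of "b * m"] assms by (smt (verit) of_nat_0_le_iff mult_nonneg_nonneg)
    finally have "\<bar>c\<bar> * m \<le> exp (b * m)" .
    moreover have "c * m \<le> \<bar>c\<bar> * m" by (intro mult_right_mono) auto
    ultimately show "c * m \<le> exp (b * m)" by linarith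
  qed
qed

lemma eventually_real_ge: "eventually (\<lambda>m. (B::real) \<le> real m) sequentially"
  using filterlim_real_sequentially by (simp add: filterlim_at_top)

text \<open>Union bound over the certificates \<open>(M, c, C, Z, \<tau>)\<close>: their number and
  the loss through \<open>Z\<close> stay below the saving of \<open>cert_count\<close>.
  \<open>K\<close> depends on \<open>\<epsilon>\<close>, but not on \<open>m\<close> or
  \<open>g\<close>.\<close>

lemma wild_rate:
  fixes \<epsilon> :: real
  assumes \<epsilon>: "0 < \<epsilon>" "\<epsilon> \<le> 1"
  shows "\<exists>K \<kappa>. 0 < \<kappa> \<and> (\<forall>\<^sub>F m in sequentially. \<forall>g.
    real (card {k \<in> kunz_tuples m g. \<not> tame K \<epsilon> m k}) * psi ^ g \<le> exp (- \<kappa> * real m))"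
proof -
  define a where "a = - ln (sqrt (1 - psi ^ 3))"
  \<comment> \<open>The saving is \<open>40 * \<kappa> * m\<close>. The choices of \<open>C\<close>,
    \<open>Z\<close> and \<open>\<tau>\<close> take at most \<open>3 * \<kappa> * m\<close> of it,
    the loss through \<open>Z\<close> another \<open>4 * \<kappa> * m\<close>, and the factor
    \<open>4 * exp 3 * m\<close> at most \<open>30 * \<kappa> * m\<close>.\<close>
  define \<kappa> where "\<kappa> = a * \<epsilon> / 40"
  have a: "0 < a"
  proof -
    have "psi ^ 3 < 1" by (rule power_less_one_iff[THEN iffD2]) auto
    moreover have "0 < psi ^ 3" by simp
    ultimately show ?thesis by (simp add: a_def ln_sqrt)
  qed
  have \<kappa>: "0 < \<kappa>" using a \<epsilon> by (simp add: \<kappa>_def)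
  obtain \<delta>1 where \<delta>1: "0 < (\<delta>1::real)" and sub1: "\<And>(A::nat set) t. finite A \<Longrightarrow> real t \<le> \<delta>1 * card A \<Longrightarrow>
      real (card {Z. Z \<subseteq> A \<and> card Z \<le> t}) \<le> exp (\<kappa> * card A)"
    by (rule small_subset_rate[OF \<kappa>, where 'a = nat]) blast
  \<comment> \<open>Fingerprints are subsets of a grid with \<open>5 * (m - 1)\<close>
    points.\<close>
  have "0 < \<kappa> / 5" using \<kappa> by simp
  then obtain \<delta>2 where \<delta>2: "0 < (\<delta>2::real)" and sub2: "\<And>(A::(nat \<times> nat) set) t. finite A \<Longrightarrow> real t \<le> \<delta>2 * card A \<Longrightarrow>
      real (card {Z. Z \<subseteq> A \<and> card Z \<le> t}) \<le> exp (\<kappa> / 5 * card A)"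
    by (rule small_subset_rate[where 'a = "nat \<times> nat"]) blast
  define \<delta> where "\<delta> = min (min \<delta>1 \<delta>2) \<kappa>"
  have \<delta>: "0 < \<delta>" "\<delta> \<le> \<delta>1" "\<delta> \<le> \<delta>2" "\<delta> \<le> \<kappa>" using \<delta>1 \<delta>2 \<kappa> by (auto simp: \<delta>_def)
  \<comment> \<open>A large \<open>d\<close> makes the fingerprint sparse, as its size is at most
    \<open>6 * (m - 1) div d\<close>. Then \<open>K\<close> is taken large against \<open>d\<close>
    to make \<open>d * (m - 1) div K\<close> small; the summand \<open>2 * K\<close> in the bound
    for \<open>Z\<close> is absorbed by large \<open>m\<close>.\<close>
  obtain d where d: "real d \<ge> 2 / \<delta>" using real_arch_simple by blast
  obtain K where K: "real K \<ge> 2 * d / \<delta> + 1" using real_arch_simple by blast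
  have d0: "0 < d" using d \<delta> by (metis divide_pos_pos of_nat_0_less_iff order_less_le_trans zero_less_numeral)
  have "0 \<le> 2 * d / \<delta>" using \<delta> by simp
  with K have K1: "1 \<le> K" by linarith
  have ev: "\<forall>\<^sub>F m in sequentially. 4 * K / \<delta> + 2 \<le> real m \<and> 4 * exp 3 * real m \<le> exp (30 * \<kappa> * m)"
    by (intro eventually_conj eventually_real_ge eventually_linear_less_exp) (use \<kappa> in auto)
  have "\<forall>g. real (card {k \<in> kunz_tuples m g. \<not> tame K \<epsilon> m k}) * psi ^ g \<le> exp (- \<kappa> * real m)"
    if m: "4 * K / \<delta> + 2 \<le> real m" "4 * exp 3 * real m \<le> exp (30 * \<kappa> * m)" for m
  proof
    fix g
    define n where "n = m - 1"
    have nm: "real n = real m - 1"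
    proof -
      have "0 \<le> 4 * K / \<delta>" using \<delta> by simp
      with m(1) have "1 \<le> m" by linarith
      then show ?thesis by (simp add: n_def)
    qed
    have Kn: "4 * real K \<le> \<delta> * n"     proof -
      have "4 * K / \<delta> \<le> n" using m(1) nm by linarith
      then show ?thesis using \<delta> by (simp add: field_simps)
    qed
    define tz where "tz = d * n div K + 2 * K"
    define tt where "tt = 6 * n div d"
    have tz: "real tz \<le> \<delta> * n"
    proof -
      have "real (d * n div K) \<le> real (d * n) / real K" by (rule real_nat_div_le)
      also have "\<dots> \<le> \<delta> / 2 * n"
      proof -
        have "2 * d / \<delta> \<le> real K" using K by simp
        then have "real d \<le> \<delta> / 2 * K" using \<delta> by (simp add: field_simps)
        then have "real d * n \<le> \<delta> / 2 * K * n" by (rule mult_right_mono) simp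
        then show ?thesis using K1 by (simp add: field_simps)
      qed
      finally show ?thesis using Kn by (simp add: tz_def)
    qed
    have tt: "real tt \<le> 5 * \<delta> * n"
    proof -
      have "real tt \<le> real (6 * n) / real d" unfolding tt_def by (rule real_nat_div_le)
      also have "\<dots> \<le> 5 * \<delta> * n"
      proof -
        have "2 \<le> \<delta> * d" using d \<delta> by (simp add: field_simps)
        then have "6 * real n \<le> (5 * (\<delta> * d)) * n" by (intro mult_right_mono) auto
        then show ?thesis using d0 by (simp add: field_simps)
      qed
      finally show ?thesis .
    qed
    let ?I = "{1..<m}"
    define CC where "CC = {C. C \<subseteq> ?I \<and> card C \<le> K}"
    define ZZ where "ZZ = {Z. Z \<subseteq> ?I \<and> card Z \<le> tz}"
    define TT where "TT = {\<tau>. \<tau> \<subseteq> ?I \<times> {1..<6::nat} \<and> card \<tau> \<le> tt}"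
    define A where "A = {3..6::nat} \<times> ?I \<times> CC \<times> ZZ \<times> TT"
    define A' where "A' = {(M, c, C, Z, \<tau>). (M, c, C, Z, \<tau>) \<in> A \<and> (M = 3 \<longrightarrow> \<epsilon> * m \<le> c)}"
    define Q where "Q = (\<lambda>(M, c, C, Z, \<tau>). {k \<in> PiE ?I (cert_range m g M c C Z \<tau>). sum k ?I = g})"
    have finC: "finite CC" "finite ZZ" "finite TT"
      unfolding CC_def ZZ_def TT_def by (auto intro!: finite_subset[OF _ finite_Pow_iff[THEN iffD2]])
    have finA: "finite A" using finC by (auto simp: A_def)
    have sub: "A' \<subseteq> A" by (auto simp: A'_def)
    have finA': "finite A'" using sub finA by (rule finite_subset)
    have finQ: "finite (Q p)" for p
    proof -
      have "finite (PiE ?I (cert_range m g M c C Z \<tau>))" for M c C Z \<tau>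
        by (rule finite_PiE) (auto simp: cert_range_def)
      then show ?thesis by (auto simp: Q_def split: prod.split)
    qed
    have cover: "{k \<in> kunz_tuples m g. \<not> tame K \<epsilon> m k} \<subseteq> (\<Union>p\<in>A'. Q p)"
    proof
      fix k assume "k \<in> {k \<in> kunz_tuples m g. \<not> tame K \<epsilon> m k}"
      then have k: "k \<in> kunz_tuples m g" "\<not> tame K \<epsilon> m k" by auto
      obtain M c C Z \<tau> where *: "M \<in> {3..6}" "c \<in> {1..<m}" "M = 3 \<longrightarrow> \<epsilon> * real m \<le> real c"
        "C \<subseteq> {1..<m}" "card C \<le> K" "Z \<subseteq> {1..<m}" "card Z \<le> d * (m - 1) div K + 2 * K"
        "\<tau> \<subseteq> {1..<m} \<times> {1..<6}" "d * card \<tau> \<le> 6 * (m - 1)"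
        "k \<in> PiE {1..<m} (cert_range m g M c C Z \<tau>)"
        by (rule cert_exists[OF k K1, where d = d]) blast
      have "card \<tau> \<le> tt" using *(9) d0
        by (simp add: tt_def n_def less_eq_div_iff_mult_less_eq mult.commute)
      then have "(M, c, C, Z, \<tau>) \<in> A'"
        using * by (simp add: A'_def A_def CC_def ZZ_def TT_def tz_def n_def)
      moreover have "k \<in> Q (M, c, C, Z, \<tau>)" using *(10) k(1) by (simp add: Q_def kunz_tuples_def)
      ultimately show "k \<in> (\<Union>p\<in>A'. Q p)" by blast
    qed
    have Qle: "real (card (Q p)) * psi ^ g \<le> exp (4 * tz + 3 - a * \<epsilon> * m)" if p: "p \<in> A'" for p
    proof -
      obtain M c C Z \<tau> where peq: "p = (M, c, C, Z, \<tau>)" by (cases p)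
      have *: "c \<in> ?I" "M \<in> {3..6}" "Z \<subseteq> ?I" "M = 3 \<Longrightarrow> \<epsilon> * m \<le> c" "card Z \<le> tz"
        using p by (auto simp: peq A'_def A_def ZZ_def)
      have "real (card (Q p)) * psi ^ g \<le> exp (4 * card Z + 3 - a * \<epsilon> * m)"
        unfolding peq Q_def prod.case a_def
        by (rule cert_count[OF *(1-4)]) (use \<epsilon> in auto)
      also have "\<dots> \<le> exp (4 * tz + 3 - a * \<epsilon> * m)" using *(5) by simp
      finally show ?thesis .
    qed
    have cardA: "real (card A) \<le> 4 * real m * exp (3 * \<kappa> * n)"
    proof -
      have cI: "card ?I = n" by (simp add: n_def)
      have 1: "real (card CC) \<le> exp (\<kappa> * n)"
      proof -
        have "real K \<le> \<delta> * n" using Kn by simp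
        also have "\<dots> \<le> \<delta>1 * n" using \<delta> by (intro mult_right_mono) auto
        finally show ?thesis using sub1[of ?I K] unfolding CC_def cI by simp
      qed
      have 2: "real (card ZZ) \<le> exp (\<kappa> * n)"
      proof -
        have "\<delta> * n \<le> \<delta>1 * n" using \<delta> by (intro mult_right_mono) auto
        then show ?thesis using tz sub1[of ?I tz] unfolding ZZ_def cI by simp
      qed
      have 3: "real (card TT) \<le> exp (\<kappa> * n)"
      proof -
        have c5: "card (?I \<times> {1..<6::nat}) = n * 5" by (simp only: card_cartesian_product cI) simp
        have "5 * (\<delta> * n) \<le> 5 * (\<delta>2 * n)" using \<delta> by (intro mult_left_mono mult_right_mono) auto
        then have "real tt \<le> \<delta>2 * real (n * 5)" using tt by (simp add: mult.assoc mult.left_commute)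
        then have "real (card TT) \<le> exp (\<kappa> / 5 * real (n * 5))"
          using sub2[of "?I \<times> {1..<6}" tt] unfolding TT_def c5 by simp
        then show ?thesis by simp
      qed
      have "real (card A) = 4 * real n * (real (card CC) * (real (card ZZ) * real (card TT)))"
        unfolding A_def by (simp add: card_cartesian_product n_def)
      also have "\<dots> \<le> 4 * real m * (exp (\<kappa> * n) * (exp (\<kappa> * n) * exp (\<kappa> * n)))"
        using 1 2 3 nm by (intro mult_mono) auto
      also have "\<dots> = 4 * real m * exp (3 * \<kappa> * n)" by (simp flip: exp_add)
      finally show ?thesis .
    qed
    have "real (card {k \<in> kunz_tuples m g. \<not> tame K \<epsilon> m k}) \<le> real (card (\<Union>p\<in>A'. Q p))"
      using cover finA' finQ by (intro of_nat_mono card_mono) auto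
    also have "\<dots> \<le> (\<Sum>p\<in>A'. real (card (Q p)))"
      using card_UN_le[OF finA', of Q] by (simp flip: of_nat_sum)
    finally have "real (card {k \<in> kunz_tuples m g. \<not> tame K \<epsilon> m k}) * psi ^ g
        \<le> (\<Sum>p\<in>A'. real (card (Q p))) * psi ^ g"
      by (rule mult_right_mono) simp
    also have "\<dots> = (\<Sum>p\<in>A'. real (card (Q p)) * psi ^ g)" by (rule sum_distrib_right)
    also have "\<dots> \<le> (\<Sum>p\<in>A'. exp (4 * tz + 3 - a * \<epsilon> * m))" by (rule sum_mono) (rule Qle)
    also have "\<dots> = real (card A') * exp (4 * tz + 3 - a * \<epsilon> * m)" by simp
    also have "\<dots> \<le> (4 * real m * exp (3 * \<kappa> * n)) * exp (4 * \<kappa> * n + 3 - 40 * \<kappa> * m)"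
    proof (rule mult_mono)
      show "real (card A') \<le> 4 * real m * exp (3 * \<kappa> * n)"
        using cardA card_mono[OF finA sub] by linarith
      have aek: "a * \<epsilon> * m = 40 * \<kappa> * m" by (simp add: \<kappa>_def)
      have "\<delta> * n \<le> \<kappa> * n" using \<delta> by (intro mult_right_mono) auto
      then show "exp (4 * tz + 3 - a * \<epsilon> * m) \<le> exp (4 * \<kappa> * n + 3 - 40 * \<kappa> * m)"
        using tz unfolding aek by simp
    qed auto
    also have "\<dots> = (4 * exp 3 * real m) * exp (7 * \<kappa> * n - 40 * \<kappa> * m)"
    proof -
      have e: "exp (3 * \<kappa> * n) * exp (4 * \<kappa> * n + 3 - 40 * \<kappa> * m) = exp 3 * exp (7 * \<kappa> * n - 40 * \<kappa> * m)"
        by (simp only: exp_add[symmetric]) (simp add: algebra_simps)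
      show ?thesis by (simp only: mult.assoc[of "4 * real m"] e) (simp only: mult_ac)
    qed
    also have "\<dots> \<le> exp (30 * \<kappa> * m) * exp (7 * \<kappa> * n - 40 * \<kappa> * m)"
      using m(2) by (intro mult_right_mono) auto
    also have "\<dots> = exp (7 * \<kappa> * n - 10 * \<kappa> * m)" by (simp flip: exp_add)
    also have "\<dots> \<le> exp (- \<kappa> * m)"
    proof -
      have "\<kappa> * n \<le> \<kappa> * m" using \<kappa> nm by (intro mult_left_mono) auto
      moreover have "0 \<le> \<kappa> * m" using \<kappa> by simp
      ultimately show ?thesis by simp
    qed
    finally show "real (card {k \<in> kunz_tuples m g. \<not> tame K \<epsilon> m k}) * psi ^ g \<le> exp (- \<kappa> * real m)" .
  qed
  then have "\<forall>\<^sub>F m in sequentially. \<forall>g.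
    real (card {k \<in> kunz_tuples m g. \<not> tame K \<epsilon> m k}) * psi ^ g \<le> exp (- \<kappa> * real m)"
    by (intro eventually_mono[OF ev]) blast
  with \<kappa> show ?thesis by blast
qed

section \<open>Deviations of tame tuples\<close>

text \<open>Fewer than \<open>2 * K\<close> indices lie in a pair reflected about \<open>c\<close>
  that has a coordinate of 4 or more. So some pair has both coordinates at most 3, and
  \<open>k c\<close> is at most \<open>3 + 3 + 1\<close>.\<close>

lemma tame_le_7:
  assumes k: "k \<in> kunz_tuples m g" and t: "tame K \<epsilon> m k" and m: "2 * K + 2 \<le> m"
    and c: "c \<in> {1..<m}"
  shows "k c \<le> 7"
proof -
  let ?I = "{1..<m} - {c}" and ?\<sigma> = "reflect m c"
  define F where "F = {i \<in> {1..<m}. 4 \<le> k i}"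
  have F: "card F < K" "finite F" using t by (auto simp: tame_def F_def)
  have "\<exists>i\<in>?I. i \<notin> F \<and> ?\<sigma> i \<notin> F"
  proof (rule ccontr)
    assume "\<not> ?thesis"
    then have *: "i \<in> F \<or> ?\<sigma> i \<in> F" if "i \<in> ?I" for i using that by blast
    have "?I \<subseteq> F \<union> ?\<sigma> ` F"
    proof
      fix i assume i: "i \<in> ?I"
      have "?\<sigma> i \<in> F \<Longrightarrow> i \<in> ?\<sigma> ` F" using reflect_reflect[OF c i] by (metis imageI)
      with *[OF i] show "i \<in> F \<union> ?\<sigma> ` F" by blast
    qed
    then have "card ?I \<le> card (F \<union> ?\<sigma> ` F)" using F by (intro card_mono) auto
    also have "\<dots> \<le> card F + card (?\<sigma> ` F)" by (rule card_Un_le)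
    also have "\<dots> \<le> card F + card F" using card_image_le[OF F(2)] by simp
    finally show False using F(1) m c by simp
  qed
  then obtain i where i: "i \<in> ?I" "i \<notin> F" "?\<sigma> i \<notin> F" by blast
  have "k i \<le> 3" "k (?\<sigma> i) \<le> 3" using i reflect_mem[OF c i(1)] by (auto simp: F_def)
  moreover have "req (k c) c i \<le> k i + k (?\<sigma> i)" by (rule kunz_tuples_reflect[OF k c i(1)]) simp
  ultimately show ?thesis by (auto simp: req_def split: if_splits)
qed

text \<open>The initial segment is counted in full; \<open>tame\<close> handles the rest.\<close>

lemma tame_card_ge_3:
  assumes "tame K \<epsilon> m k" "0 \<le> \<epsilon>"
  shows "real (card {i \<in> {1..<m}. 3 \<le> k i}) \<le> \<epsilon> * m + K + 1"
proof -
  have "{i \<in> {1..<m}. 3 \<le> k i} \<subseteq> {..nat \<lfloor>\<epsilon> * m\<rfloor>} \<union> {i \<in> {1..<m}. \<epsilon> * real m \<le> real i \<and> 3 \<le> k i}" (is "?L \<subseteq> ?A \<union> ?B")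
    using le_nat_floor[of _ "\<epsilon> * real m"] by force
  then have "card ?L \<le> card (?A \<union> ?B)" by (intro card_mono) auto
  also have "\<dots> \<le> card ?A + card ?B" by (rule card_Un_le)
  finally have "real (card ?L) \<le> card ?A + card ?B" by linarith
  moreover have "real (card ?A) \<le> \<epsilon> * m + 1" using assms(2) by (simp add: of_nat_floor)
  moreover have "card ?B < K" using assms(1) by (simp add: tame_def)
  ultimately show ?thesis by linarith
qed

text \<open>For negative \<open>s\<close> the product \<open>(1 + s + s\<^sup>2) * (1 - s)\<close>
  equals \<open>1 - s ^ 3\<close>, which is at least 1, while \<open>1 - s\<close> is at most
  \<open>exp (- s)\<close>.\<close>

lemma exp_le_quadratic:
  fixes s :: real
  assumes "\<bar>s\<bar> \<le> 1"
  shows "exp s \<le> 1 + s + s\<^sup>2"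
proof (cases "0 \<le> s")
  case True
  then show ?thesis using exp_bound[of s] assms by simp
next
  case False
  have "0 \<le> (- s) ^ 3" using False by (intro zero_le_power) simp
  then have "1 \<le> 1 + (- s) ^ 3" by linarith
  also have "\<dots> = (1 + s + s\<^sup>2) * (1 - s)"
    by (simp add: power2_eq_square power3_eq_cube algebra_simps)
  also have "\<dots> \<le> (1 + s + s\<^sup>2) * exp (- s)"
  proof (rule mult_left_mono)
    show "1 - s \<le> exp (- s)" using exp_ge_add_one_self[of "- s"] by simp
    have "0 \<le> (1/2 + s)\<^sup>2" by simp
    then show "0 \<le> 1 + s + s\<^sup>2" by (simp add: power2_eq_square algebra_simps)
  qed
  finally show ?thesis by (simp add: exp_minus field_simps)
qed

text \<open>The left side is the moment generating function of the centred variable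
  \<open>k - 1 - psi\<^sup>2\<close>, where \<open>k\<close> is 1 with probability
  \<open>psi\<close> and 2 with probability \<open>psi\<^sup>2\<close>.\<close>

lemma bernoulli_mgf:
  fixes s :: real
  assumes "\<bar>s\<bar> \<le> 1"
  shows "psi * exp (- s * psi\<^sup>2) + psi\<^sup>2 * exp (s * (1 - psi\<^sup>2)) \<le> exp (s\<^sup>2)"
proof -
  let ?p = "psi\<^sup>2"
  have p: "0 \<le> ?p" "?p \<le> 1" "psi = 1 - ?p" by (simp_all add: psi_square)
  have "psi * exp (- s * ?p) + ?p * exp (s * (1 - ?p)) = exp (- s * ?p) * (psi + ?p * exp s)"
    by (simp add: exp_diff exp_minus algebra_simps divide_inverse)
  also have "\<dots> \<le> exp (- s * ?p) * (psi + ?p * (1 + s + s\<^sup>2))"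
    using exp_le_quadratic[OF assms] p by (intro mult_left_mono add_left_mono) auto
  also have "\<dots> \<le> exp (- s * ?p) * exp (?p * s + s\<^sup>2)"
  proof (rule mult_left_mono)
    have "?p * s\<^sup>2 \<le> 1 * s\<^sup>2" using p by (intro mult_right_mono) auto
    then have "psi + ?p * (1 + s + s\<^sup>2) \<le> 1 + (?p * s + s\<^sup>2)"
      using p(3) by (simp add: algebra_simps)
    also have "\<dots> \<le> exp (?p * s + s\<^sup>2)" by (rule exp_ge_add_one_self)
    finally show "psi + ?p * (1 + s + s\<^sup>2) \<le> exp (?p * s + s\<^sup>2)" .
  qed simp
  also have "\<dots> = exp (s\<^sup>2)" by (simp flip: exp_add add: mult.commute)
  finally show ?thesis .
qed

text \<open>Chernoff bound by exponential tilting of the weights. A coordinate off \<open>E\<close>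
  contributes at most \<open>exp (\<mu>\<^sup>2)\<close> by \<open>bernoulli_mgf\<close>; on
  \<open>E\<close>, which will be sparse, the crude bound \<open>7 * exp 7\<close>, at most
  \<open>exp 14\<close>, is enough.\<close>

lemma tilted_count:
  fixes \<mu> :: real and t :: "nat \<Rightarrow> real"
  assumes \<mu>: "0 \<le> \<mu>" "\<mu> \<le> 1" and t: "\<And>i. i \<in> {1..<m} \<Longrightarrow> \<bar>t i\<bar> \<le> 1" and E: "E \<subseteq> {1..<m}"
  shows "real (card {k \<in> PiE {1..<m} (\<lambda>i. if i \<in> E then {1..7} else {1..2}). sum k {1..<m} = g \<and>
      \<theta> \<le> (\<Sum>i\<in>{1..<m}. t i * (real (k i) - 1 - psi\<^sup>2))}) * psi ^ g
    \<le> exp (14 * card E + \<mu>\<^sup>2 * m - \<mu> * \<theta>)" (is "real (card ?Q) * _ \<le> _")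
proof -
  let ?I = "{1..<m}" and ?V = "\<lambda>i. if i \<in> E then {1..7::nat} else {1..2}"
  define w where "w i v = psi ^ v * exp (\<mu> * (t i * (real v - 1 - psi\<^sup>2)))" for i and v :: nat
  have finE: "finite E" using E finite_subset by blast
  have p: "0 \<le> psi\<^sup>2" "psi\<^sup>2 \<le> 1" by (simp_all add: psi_square)
  have prodw: "(\<Prod>i\<in>?I. w i (k i)) = psi ^ (sum k ?I) * exp (\<mu> * (\<Sum>i\<in>?I. t i * (real (k i) - 1 - psi\<^sup>2)))" for k
    by (simp add: w_def prod.distrib power_sum exp_sum sum_distrib_left)
  have s: "\<bar>\<mu> * t i\<bar> \<le> \<mu>" if "i \<in> ?I" for i
    using mult_left_mono[OF t[OF that] \<mu>(1)] \<mu>(1) by (simp add: abs_mult)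
  have "real (card ?Q) * (psi ^ g * exp (\<mu> * \<theta>)) \<le> (\<Prod>i\<in>?I. \<Sum>v\<in>?V i. w i v)"
  proof (rule card_PiE_weighted_le)
    fix k assume k: "k \<in> ?Q"
    then have "\<mu> * \<theta> \<le> \<mu> * (\<Sum>i\<in>?I. t i * (real (k i) - 1 - psi\<^sup>2))"
      using \<mu>(1) by (intro mult_left_mono) auto
    with k show "k \<in> PiE ?I ?V \<and> psi ^ g * exp (\<mu> * \<theta>) \<le> (\<Prod>i\<in>?I. w i (k i))"
      unfolding prodw by auto
  qed (auto simp: w_def)
  also have "\<dots> \<le> (\<Prod>i\<in>?I. if i \<in> E then exp 14 else exp (\<mu>\<^sup>2))"
  proof (rule prod_mono, intro conjI)
    fix i assume i: "i \<in> ?I"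
    show "0 \<le> (\<Sum>v\<in>?V i. w i v)" by (auto intro!: sum_nonneg simp: w_def)
    show "(\<Sum>v\<in>?V i. w i v) \<le> (if i \<in> E then exp 14 else exp (\<mu>\<^sup>2))"
    proof (cases "i \<in> E")
      case True
      have "w i v \<le> exp 7" if "v \<in> {1..7}" for v
      proof -
        have "\<mu> * (t i * (real v - 1 - psi\<^sup>2)) \<le> \<bar>\<mu> * t i\<bar> * \<bar>real v - 1 - psi\<^sup>2\<bar>"
          by (simp add: abs_mult[symmetric] mult.assoc)
        also have "\<dots> \<le> 1 * 7"
        proof (rule mult_mono)
          have "1 \<le> real v" "real v \<le> 7" using that by auto
          then show "\<bar>real v - 1 - psi\<^sup>2\<bar> \<le> 7" using p by linarith
        qed (use s[OF i] \<mu> in auto)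
        finally have "exp (\<mu> * (t i * (real v - 1 - psi\<^sup>2))) \<le> exp 7" by simp
        moreover have "psi ^ v \<le> 1" by (rule power_le_one) auto
        ultimately have "psi ^ v * exp (\<mu> * (t i * (real v - 1 - psi\<^sup>2))) \<le> 1 * exp 7"
          by (intro mult_mono) auto
        then show ?thesis by (simp add: w_def)
      qed
      then have "(\<Sum>v=1..7. w i v) \<le> (\<Sum>v=1..7::nat. exp 7)" by (intro sum_mono) auto
      also have "\<dots> = 7 * exp 7" by simp
      also have "\<dots> \<le> exp 7 * exp 7"
      proof (rule mult_right_mono)
        show "7 \<le> exp (7::real)" using exp_ge_add_one_self[of 7] by simp
      qed simp
      also have "\<dots> = exp 14" by (simp flip: exp_add)
      finally show ?thesis using True by simp
    next
      case False
      have "(\<Sum>v\<in>{1..2}. w i v) = w i 1 + w i 2" by (simp add: numeral_2_eq_2)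
      also have "\<dots> = psi * exp (- (\<mu> * t i) * psi\<^sup>2) + psi\<^sup>2 * exp ((\<mu> * t i) * (1 - psi\<^sup>2))"
        by (simp add: w_def mult.assoc)
      also have "\<dots> \<le> exp ((\<mu> * t i)\<^sup>2)" by (rule bernoulli_mgf) (use s[OF i] \<mu> in linarith)
      also have "\<dots> \<le> exp (\<mu>\<^sup>2)" using power_mono[OF s[OF i], of 2] by simp
      finally show ?thesis using False by simp
    qed
  qed
  also have "\<dots> = exp 14 ^ card E * exp (\<mu>\<^sup>2) ^ card (?I - E)"
  proof -
    have "?I \<inter> E = E" using E by auto
    then show ?thesis by (simp add: prod.If_cases Diff_eq)
  qed
  also have "\<dots> = exp (14 * card E + \<mu>\<^sup>2 * card (?I - E))"
    by (simp add: exp_add exp_of_nat2_mult)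
  also have "\<dots> \<le> exp (14 * card E + \<mu>\<^sup>2 * m)"
  proof -
    have "card (?I - E) \<le> card ?I" by (intro card_mono) auto
    then have "\<mu>\<^sup>2 * card (?I - E) \<le> \<mu>\<^sup>2 * m" by (intro mult_left_mono) auto
    then show ?thesis by simp
  qed
  finally have "real (card ?Q) * psi ^ g * exp (\<mu> * \<theta>) \<le> exp (14 * card E + \<mu>\<^sup>2 * m)" by (simp add: mult.assoc)
  then show ?thesis by (simp add: exp_diff field_simps)
qed

text \<open>Union bound over the sparse set \<open>E\<close> of coordinates that are at least 3. The
  constants \<open>\<epsilon>0\<close> and \<open>\<kappa>\<close> come before \<open>K\<close>,
  because \<open>wild_rate\<close> supplies \<open>K\<close> only once \<open>\<epsilon>\<close> is
  chosen.\<close>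

lemma tame_deviation_rate:
  fixes \<eta> :: real
  assumes \<eta>: "0 < \<eta>" "\<eta> \<le> 1"
  shows "\<exists>\<epsilon>0 \<kappa>. 0 < \<epsilon>0 \<and> 0 < \<kappa> \<and> (\<forall>\<epsilon> K. 0 < \<epsilon> \<longrightarrow> \<epsilon> \<le> \<epsilon>0 \<longrightarrow> (\<forall>\<^sub>F m in sequentially. \<forall>g t.
    (\<forall>i\<in>{1..<m}. \<bar>t i\<bar> \<le> 1) \<longrightarrow>
    real (card {k \<in> kunz_tuples m g. tame K \<epsilon> m k \<and>
      \<eta> * m \<le> (\<Sum>i\<in>{1..<m}. t i * (real (k i) - 1 - psi\<^sup>2))}) * psi ^ g \<le> exp (- \<kappa> * real m)))"
proof -
  \<comment> \<open>With tilt \<open>\<eta> / 2\<close> the exponent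
    \<open>\<mu>\<^sup>2 - \<mu> * \<eta>\<close> takes its minimum
    \<open>- \<eta>\<^sup>2 / 4\<close>, that is \<open>- 3 * \<kappa>\<close>. One
    \<open>\<kappa>\<close> pays for the coordinates in \<open>E\<close> and one for the choice of
    \<open>E\<close>.\<close>
  define \<kappa> where "\<kappa> = \<eta>\<^sup>2 / 12"
  have \<kappa>: "0 < \<kappa>" using \<eta> by (simp add: \<kappa>_def)
  obtain \<delta> where \<delta>: "0 < (\<delta>::real)" and sub: "\<And>(A::nat set) t. finite A \<Longrightarrow> real t \<le> \<delta> * card A \<Longrightarrow>
      real (card {Z. Z \<subseteq> A \<and> card Z \<le> t}) \<le> exp (\<kappa> * card A)"
    by (rule small_subset_rate[OF \<kappa>, where 'a = nat]) blast
  define \<epsilon>0 where "\<epsilon>0 = min (\<delta> / 4) (\<kappa> / 28)"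
  have \<epsilon>0: "0 < \<epsilon>0" "\<epsilon>0 \<le> \<delta> / 4" "\<epsilon>0 \<le> \<kappa> / 28" using \<delta> \<kappa> by (auto simp: \<epsilon>0_def)
  have main: "real (card {k \<in> kunz_tuples m g. tame K \<epsilon> m k \<and>
      \<eta> * m \<le> (\<Sum>i\<in>{1..<m}. t i * (real (k i) - 1 - psi\<^sup>2))}) * psi ^ g \<le> exp (- \<kappa> * real m)"
    if \<epsilon>: "0 < \<epsilon>" "\<epsilon> \<le> \<epsilon>0" and m: "(real K + 1) / \<epsilon> \<le> real m" "real (2 * K + 2) \<le> real m"
      and t: "\<forall>i\<in>{1..<m}. \<bar>t i\<bar> \<le> 1" for \<epsilon> K m g t
  proof -
    let ?I = "{1..<m}"
    have m2: "2 \<le> m" "2 * K + 2 \<le> m" using m(2) by linarith+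
    define tE where "tE = nat \<lfloor>2 * \<epsilon> * m\<rfloor>"
    have tE: "real tE \<le> 2 * \<epsilon> * m" unfolding tE_def using \<epsilon> by (intro of_nat_floor) auto
    define EE where "EE = {E. E \<subseteq> ?I \<and> card E \<le> tE}"
    define Q where "Q E = {k \<in> PiE ?I (\<lambda>i. if i \<in> E then {1..7} else {1..2}). sum k ?I = g \<and>
      \<eta> * m \<le> (\<Sum>i\<in>?I. t i * (real (k i) - 1 - psi\<^sup>2))}" for E
    have finEE: "finite EE" unfolding EE_def by (auto intro!: finite_subset[OF _ finite_Pow_iff[THEN iffD2]])
    have finQ: "finite (Q E)" for E
    proof -
      have "finite (PiE ?I (\<lambda>i. if i \<in> E then {1..7::nat} else {1..2}))" by (rule finite_PiE) auto
      then show ?thesis by (simp add: Q_def)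
    qed
    let ?D = "{k \<in> kunz_tuples m g. tame K \<epsilon> m k \<and> \<eta> * m \<le> (\<Sum>i\<in>?I. t i * (real (k i) - 1 - psi\<^sup>2))}"
    have "?D \<subseteq> (\<Union>E\<in>EE. Q E)"
    proof
      fix k assume kD: "k \<in> ?D"
      then have k: "k \<in> kunz_tuples m g" "tame K \<epsilon> m k" by auto
      define E where "E = {i \<in> ?I. 3 \<le> k i}"
      have "real (card E) \<le> \<epsilon> * m + K + 1" unfolding E_def by (rule tame_card_ge_3[OF k(2)]) (use \<epsilon> in simp)
      moreover have "real K + 1 \<le> \<epsilon> * m" using m(1) \<epsilon> by (simp add: field_simps)
      ultimately have "real (card E) \<le> 2 * \<epsilon> * m" by simp
      then have "card E \<le> tE" unfolding tE_def by (rule le_nat_floor)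
      then have "E \<in> EE" by (auto simp: EE_def E_def)
      moreover have "k \<in> Q E"
      proof -
        have "k i \<in> (if i \<in> E then {1..7} else {1..2})" if "i \<in> ?I" for i
          using kunz_tuples_mem(1)[OF k(1) that] tame_le_7[OF k m2(2) that] that by (auto simp: E_def)
        moreover have "k \<in> extensional ?I" "sum k ?I = g" using k by (auto simp: kunz_tuples_def PiE_def)
        ultimately show ?thesis using kD by (auto simp: Q_def PiE_def)
      qed
      ultimately show "k \<in> (\<Union>E\<in>EE. Q E)" by blast
    qed
    then have "real (card ?D) \<le> real (card (\<Union>E\<in>EE. Q E))"
      using finEE finQ by (intro of_nat_mono card_mono) auto
    also have "\<dots> \<le> (\<Sum>E\<in>EE. real (card (Q E)))"
      using card_UN_le[OF finEE, of Q] by (simp flip: of_nat_sum)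
    finally have "real (card ?D) * psi ^ g \<le> (\<Sum>E\<in>EE. real (card (Q E))) * psi ^ g"
      by (rule mult_right_mono) simp
    also have "\<dots> = (\<Sum>E\<in>EE. real (card (Q E)) * psi ^ g)" by (rule sum_distrib_right)
    also have "\<dots> \<le> (\<Sum>E\<in>EE. exp (- 2 * \<kappa> * m))"
    proof (rule sum_mono)
      fix E assume E: "E \<in> EE"
      have "real (card (Q E)) * psi ^ g \<le> exp (14 * card E + (\<eta> / 2)\<^sup>2 * m - \<eta> / 2 * (\<eta> * m))"
        unfolding Q_def by (rule tilted_count) (use E t \<eta> in \<open>auto simp: EE_def\<close>)
      also have "\<dots> \<le> exp (- 2 * \<kappa> * m)"
      proof -
        have "14 * real (card E) \<le> 28 * \<epsilon> * m" using E tE by (simp add: EE_def)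
        also have "\<dots> \<le> \<kappa> * m" using \<epsilon> \<epsilon>0 by (intro mult_right_mono) auto
        finally have "14 * real (card E) + 12 * \<kappa> / 4 * m - 12 * \<kappa> / 2 * m \<le> - 2 * \<kappa> * m" by simp
        then show ?thesis by (simp add: \<kappa>_def power2_eq_square algebra_simps)
      qed
      finally show "real (card (Q E)) * psi ^ g \<le> exp (- 2 * \<kappa> * m)" .
    qed
    also have "\<dots> = real (card EE) * exp (- 2 * \<kappa> * m)" by simp
    also have "\<dots> \<le> exp (\<kappa> * m) * exp (- 2 * \<kappa> * m)"
    proof (rule mult_right_mono)
      have cI: "card ?I = m - 1" by simp
      have "2 * \<epsilon> * m \<le> \<delta> / 2 * m" using \<epsilon> \<epsilon>0 by (intro mult_right_mono) auto
      also have "\<delta> / 2 * m = \<delta> * (m / 2)" by simp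
      also have "\<dots> \<le> \<delta> * real (m - 1)" using m2 \<delta> by (intro mult_left_mono) auto
      finally have "real tE \<le> \<delta> * real (m - 1)" using tE by linarith
      then have "real (card EE) \<le> exp (\<kappa> * real (m - 1))"
        using sub[of ?I tE] unfolding EE_def cI by simp
      also have "\<dots> \<le> exp (\<kappa> * m)" using \<kappa> by simp
      finally show "real (card EE) \<le> exp (\<kappa> * m)" .
    qed simp
    also have "\<dots> = exp (- \<kappa> * m)" by (simp flip: exp_add)
    finally show ?thesis .
  qed
  show ?thesis
  proof (intro exI conjI allI impI)
    fix \<epsilon> :: real and K :: nat assume \<epsilon>: "0 < \<epsilon>" "\<epsilon> \<le> \<epsilon>0"
    have "\<forall>\<^sub>F m in sequentially. (real K + 1) / \<epsilon> \<le> real m \<and> real (2 * K + 2) \<le> real m"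
      by (intro eventually_conj eventually_real_ge)
    then show "\<forall>\<^sub>F m in sequentially. \<forall>g t. (\<forall>i\<in>{1..<m}. \<bar>t i\<bar> \<le> 1) \<longrightarrow>
      real (card {k \<in> kunz_tuples m g. tame K \<epsilon> m k \<and>
        \<eta> * m \<le> (\<Sum>i\<in>{1..<m}. t i * (real (k i) - 1 - psi\<^sup>2))}) * psi ^ g \<le> exp (- \<kappa> * real m)"
    proof (rule eventually_mono, intro allI impI)
      fix m g :: nat and t :: "nat \<Rightarrow> real"
      assume "(real K + 1) / \<epsilon> \<le> real m \<and> real (2 * K + 2) \<le> real m" "\<forall>i\<in>{1..<m}. \<bar>t i\<bar> \<le> 1"
      then show "real (card {k \<in> kunz_tuples m g. tame K \<epsilon> m k \<and>
        \<eta> * m \<le> (\<Sum>i\<in>{1..<m}. t i * (real (k i) - 1 - psi\<^sup>2))}) * psi ^ g \<le> exp (- \<kappa> * real m)"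
        by (intro main[OF \<epsilon>]) auto
    qed
  qed (use \<epsilon>0 \<kappa> in auto)
qed

section \<open>Kunz coordinates of numerical semigroups\<close>

definition multiplicity_of :: "nat set \<Rightarrow> nat" where
  "multiplicity_of S = (LEAST x. x \<in> S \<and> 0 < x)"

text \<open>For a numerical semigroup, \<open>i + kunz S i * multiplicity_of S\<close> is the least
  element of \<open>S\<close> congruent to \<open>i\<close>, the Apery element of its class.\<close>

definition kunz :: "nat set \<Rightarrow> nat \<Rightarrow> nat" where
  "kunz S = (\<lambda>i\<in>{1..<multiplicity_of S}. LEAST t. i + t * multiplicity_of S \<in> S)"

definition kunz_gaps :: "nat \<Rightarrow> (nat \<Rightarrow> nat) \<Rightarrow> nat set" where
  "kunz_gaps m k = (\<lambda>(i, t). i + t * m) ` (SIGMA i:{1..<m}. {..<k i})"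

lemma kunz_gaps_inj:
  fixes m :: nat
  shows "inj_on (\<lambda>(i, t). i + t * m) (SIGMA i:{1..<m}. {..<k i})"
proof (rule inj_onI, clarify)
  fix i t i' t' assume "i \<in> {1..<m}" "i' \<in> {1..<m}" and eq: "i + t * m = i' + t' * m"
  then have lt: "i < m" "i' < m" by auto
  have "(i + t * m) mod m = (i' + t' * m) mod m" "(i + t * m) div m = (i' + t' * m) div m"
    using eq by simp_all
  then show "i = i' \<and> t = t'" using lt by simp
qed

lemma card_kunz_gaps: "card (kunz_gaps m k) = sum k {1..<m}"
  unfolding kunz_gaps_def card_image[OF kunz_gaps_inj] by (subst card_SigmaI) auto

lemma sum_kunz_gaps: "(\<Sum>x\<in>kunz_gaps m k. f x) = (\<Sum>i\<in>{1..<m}. \<Sum>t<k i. f (i + t * m))"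
  unfolding kunz_gaps_def by (subst sum.reindex[OF kunz_gaps_inj]) (simp add: sum.Sigma split_def)

context
  fixes S :: "nat set"
  assumes S: "numerical_semigroup S"
begin

private lemma zero_mem: "0 \<in> S" and add_mem: "x \<in> S \<Longrightarrow> y \<in> S \<Longrightarrow> x + y \<in> S"
  and finite_gaps: "finite (gaps S)"
  using S by (auto simp: numerical_semigroup_def gaps_def)

private abbreviation "m \<equiv> multiplicity_of S"

lemma large_mem: "\<exists>B. \<forall>x\<ge>B. x \<in> S"
proof -
  obtain B where "\<forall>x\<in>gaps S. x \<le> B" using finite_gaps finite_nat_set_iff_bounded_le by blast
  then have "\<forall>x\<ge>Suc B. x \<in> S" by (force simp: gaps_def)
  then show ?thesis ..
qed

lemma multiplicity_mem: "m \<in> S" "0 < m"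
proof -
  obtain B where "\<forall>x\<ge>B. x \<in> S" using large_mem by blast
  then have "Suc B \<in> S \<and> 0 < Suc B" by simp
  then have "m \<in> S \<and> 0 < m" unfolding multiplicity_of_def by (rule LeastI)
  then show "m \<in> S" "0 < m" by auto
qed

lemma less_multiplicity: "i \<in> {1..<m} \<Longrightarrow> i \<notin> S"
  using not_less_Least[of i "\<lambda>x. x \<in> S \<and> 0 < x"] by (auto simp: multiplicity_of_def)

private lemma mult_mem: "t * m \<in> S"
  by (induction t) (use zero_mem multiplicity_mem add_mem in auto)

text \<open>Adding the multiplicity does not leave \<open>S\<close>, so membership along a residue
  class is upward closed.\<close>

lemma kunz_mem_iff:
  assumes i: "i \<in> {1..<m}"
  shows "i + t * m \<in> S \<longleftrightarrow> kunz S i \<le> t"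
proof -
  have k: "kunz S i = (LEAST t. i + t * m \<in> S)" using i by (simp add: kunz_def)
  obtain B where "\<forall>x\<ge>B. x \<in> S" using large_mem by blast
  moreover have "B \<le> i + B * m" using multiplicity_mem(2) by (simp add: trans_le_add2)
  ultimately have "i + B * m \<in> S" by blast
  then have mem: "i + kunz S i * m \<in> S" unfolding k by (rule LeastI)
  show ?thesis
  proof
    assume "i + t * m \<in> S"
    then show "kunz S i \<le> t" unfolding k by (rule Least_le)
  next
    assume "kunz S i \<le> t"
    then have "i + t * m = (i + kunz S i * m) + (t - kunz S i) * m"
      by (simp add: algebra_simps flip: distrib_right)
    then show "i + t * m \<in> S" using add_mem[OF mem mult_mem] by metis
  qed
qed

lemma gaps_eq_kunz_gaps: "gaps S = kunz_gaps m (kunz S)"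
proof (intro equalityI subsetI)
  fix x assume x: "x \<in> gaps S"
  define i where "i = x mod m"
  define t where "t = x div m"
  have xeq: "x = i + t * m" by (simp add: i_def t_def)
  have "x \<notin> S" using x by (simp add: gaps_def)
  then have "i \<noteq> 0" using mult_mem[of t] unfolding xeq by (metis add_0)
  then have i: "i \<in> {1..<m}" using multiplicity_mem(2) by (simp add: i_def)
  have "t < kunz S i" using x kunz_mem_iff[OF i, of t] xeq by (auto simp: gaps_def)
  then have "(i, t) \<in> (SIGMA i:{1..<m}. {..<kunz S i})" using i by simp
  then show "x \<in> kunz_gaps m (kunz S)" unfolding kunz_gaps_def xeq by force
next
  fix x assume "x \<in> kunz_gaps m (kunz S)"
  then obtain i t where i: "i \<in> {1..<m}" and t: "t < kunz S i" and x: "x = i + t * m"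
    by (auto simp: kunz_gaps_def)
  show "x \<in> gaps S" using kunz_mem_iff[OF i, of t] t unfolding x gaps_def by simp
qed

lemma genus_eq_sum_kunz: "genus S = sum (kunz S) {1..<m}"
  by (simp add: genus_def gaps_eq_kunz_gaps card_kunz_gaps)

lemma multiplicity_le: "m \<le> genus S + 1"
proof -
  have "{1..<m} \<subseteq> gaps S" using less_multiplicity by (auto simp: gaps_def)
  then have "card {1..<m} \<le> genus S" unfolding genus_def by (rule card_mono[OF finite_gaps])
  then show ?thesis by simp
qed

text \<open>The least elements of the classes \<open>i\<close> and \<open>j\<close> add up to an
  element of \<open>S\<close>, which bounds the least element of the class of \<open>i + j\<close>;
  wrapping the index contributes one more multiple of \<open>m\<close>.\<close>

lemma kunz_mem_kunz_tuples: "kunz S \<in> kunz_tuples m (genus S)"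
proof -
  have "kunz S i \<in> {1..genus S}" if i: "i \<in> {1..<m}" for i
  proof -
    have "\<not> kunz S i \<le> 0" using kunz_mem_iff[OF i, of 0] less_multiplicity[OF i] by simp
    moreover have "kunz S i \<le> genus S"
      unfolding genus_eq_sum_kunz by (rule member_le_sum) (use i in auto)
    ultimately show ?thesis by simp
  qed
  moreover have "kunz S \<in> extensional {1..<m}" by (simp add: kunz_def)
  moreover have "(i + j < m \<longrightarrow> kunz S (i + j) \<le> kunz S i + kunz S j) \<and>
        (m < i + j \<longrightarrow> kunz S (i + j - m) \<le> kunz S i + kunz S j + 1)"
    if i: "i \<in> {1..<m}" and j: "j \<in> {1..<m}" for i j
  proof -
    have mem: "(i + kunz S i * m) + (j + kunz S j * m) \<in> S"
      using kunz_mem_iff[OF i, of "kunz S i"] kunz_mem_iff[OF j, of "kunz S j"] add_mem by blast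
    show ?thesis
    proof (intro conjI impI)
      assume "i + j < m"
      then have "i + j \<in> {1..<m}" using i by simp
      moreover have "(i + j) + (kunz S i + kunz S j) * m \<in> S" using mem by (simp add: algebra_simps)
      ultimately show "kunz S (i + j) \<le> kunz S i + kunz S j" by (simp only: kunz_mem_iff)
    next
      assume lt: "m < i + j"
      then have "i + j - m \<in> {1..<m}" using i j by auto
      moreover have "(i + j - m) + (kunz S i + kunz S j + 1) * m \<in> S"
      proof -
        have "(i + j - m) + (kunz S i + kunz S j + 1) * m = (i + kunz S i * m) + (j + kunz S j * m)"
          using lt by (simp add: algebra_simps)
        then show ?thesis using mem by metis
      qed
      ultimately show "kunz S (i + j - m) \<le> kunz S i + kunz S j + 1" by (simp only: kunz_mem_iff)
    qed
  qed
  ultimately show ?thesis unfolding kunz_tuples_def PiE_def by (auto simp: genus_eq_sum_kunz)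
qed

text \<open>For a gap \<^term>\<open>x\<close>, one of \<^term>\<open>y\<close> and \<^term>\<open>x - y\<close> is always a gap.\<close>

lemma gap_less_twice_genus:
  assumes x: "x \<in> gaps S"
  shows "x < 2 * genus S"
proof -
  have "{..x} \<subseteq> gaps S \<union> (\<lambda>y. x - y) ` gaps S"
  proof
    fix y assume y: "y \<in> {..x}"
    then have "y + (x - y) = x" by simp
    then have "y \<in> gaps S \<or> x - y \<in> gaps S" using x add_mem[of y "x - y"] by (auto simp: gaps_def)
    moreover have "x - (x - y) = y" using y by simp
    ultimately show "y \<in> gaps S \<union> (\<lambda>y. x - y) ` gaps S" by (metis UnCI imageI)
  qed
  then have "card {..x} \<le> card (gaps S \<union> (\<lambda>y. x - y) ` gaps S)"
    by (intro card_mono) (use finite_gaps in auto)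
  also have "\<dots> \<le> card (gaps S) + card ((\<lambda>y. x - y) ` gaps S)" by (rule card_Un_le)
  also have "\<dots> \<le> genus S + genus S" using card_image_le[OF finite_gaps] by (simp add: genus_def)
  finally show ?thesis by simp
qed

text \<open>Crude, but enough to limit what exceptional semigroups contribute to the
  expectation.\<close>

lemma weight_bounds: "\<bar>real_of_int (weight S)\<bar> \<le> 2 * (real (genus S))\<^sup>2"
proof -
  let ?g = "genus S"
  have "(\<Sum>x\<in>gaps S. x) \<le> (\<Sum>x\<in>gaps S. 2 * ?g)"
    using gap_less_twice_genus by (intro sum_mono) (simp add: less_imp_le)
  also have "\<dots> = 2 * ?g\<^sup>2" by (simp add: genus_def power2_eq_square)
  finally have 1: "real (\<Sum>x\<in>gaps S. x) \<le> 2 * (real ?g)\<^sup>2"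
    using of_nat_mono by fastforce
  have "?g * (?g + 1) div 2 \<le> ?g * (2 * ?g) div 2" by (cases "?g = 0") (simp, intro div_le_mono mult_le_mono2, simp)
  also have "\<dots> = ?g\<^sup>2" by (simp add: power2_eq_square)
  finally have 2: "real (?g * (?g + 1) div 2) \<le> (real ?g)\<^sup>2"
    using of_nat_mono by fastforce
  have eq: "real_of_int (weight S) = real (\<Sum>x\<in>gaps S. x) - real (?g * (?g + 1) div 2)"
    by (simp add: weight_def)
  have "0 \<le> real (\<Sum>x\<in>gaps S. x)" "0 \<le> real (?g * (?g + 1) div 2)" by (rule of_nat_0_le_iff)+
  with 1 2 show ?thesis unfolding eq by linarith
qed

end

lemma semigroup_kunz_inj: "inj_on (\<lambda>S. (multiplicity_of S, kunz S)) {S. numerical_semigroup S}"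
proof (rule inj_onI)
  fix S T assume *: "S \<in> {S. numerical_semigroup S}" "T \<in> {S. numerical_semigroup S}"
    "(multiplicity_of S, kunz S) = (multiplicity_of T, kunz T)"
  then have "gaps S = gaps T" using gaps_eq_kunz_gaps[of S] gaps_eq_kunz_gaps[of T] by simp
  then show "S = T" by (auto simp: gaps_def)
qed

text \<open>Multiplicity and Kunz tuple together determine the semigroup, and the multiplicity is at
  most \<open>g + 1\<close>.\<close>

lemma
  shows finite_semigroups_of_genus: "finite (semigroups_of_genus g)"
    and card_semigroups_le: "card {S \<in> semigroups_of_genus g. P (multiplicity_of S) (kunz S)}
      \<le> (\<Sum>m\<in>{1..g+1}. card {k \<in> kunz_tuples m g. P m k})"
proof -
  let ?f = "\<lambda>S. (multiplicity_of S, kunz S)"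
  have inj: "inj_on ?f (semigroups_of_genus g)"
    by (rule inj_on_subset[OF semigroup_kunz_inj]) (auto simp: semigroups_of_genus_def)
  have sub: "?f ` {S \<in> semigroups_of_genus g. P (multiplicity_of S) (kunz S)}
      \<subseteq> (SIGMA m:{1..g+1}. {k \<in> kunz_tuples m g. P m k})" for P
    using multiplicity_mem multiplicity_le kunz_mem_kunz_tuples
    by (fastforce simp: semigroups_of_genus_def)
  have fin: "finite (SIGMA m:{1..g+1}. {k \<in> kunz_tuples m g. P m k})" for P
    by (intro finite_SigmaI) (auto simp: finite_kunz_tuples)
  show "finite (semigroups_of_genus g)"
    using finite_subset[OF sub[of "\<lambda>_ _. True"] fin] finite_imageD[OF _ inj] by simp
  have "card {S \<in> semigroups_of_genus g. P (multiplicity_of S) (kunz S)}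
      = card (?f ` {S \<in> semigroups_of_genus g. P (multiplicity_of S) (kunz S)})"
    by (rule card_image[symmetric], rule inj_on_subset[OF inj]) auto
  also have "\<dots> \<le> card (SIGMA m:{1..g+1}. {k \<in> kunz_tuples m g. P m k})"
    by (rule card_mono[OF fin sub])
  also have "\<dots> = (\<Sum>m\<in>{1..g+1}. card {k \<in> kunz_tuples m g. P m k})"
    by (rule card_SigmaI) (auto simp: finite_kunz_tuples)
  finally show "card {S \<in> semigroups_of_genus g. P (multiplicity_of S) (kunz S)}
      \<le> (\<Sum>m\<in>{1..g+1}. card {k \<in> kunz_tuples m g. P m k})" .
qed

section \<open>Exponential lower bound for the number of semigroups\<close>

text \<open>The gaps are \<open>1, ..., mm j - 1\<close> and any \<open>j\<close> numbers strictly
  between \<open>mm j\<close> and \<open>2 * mm j\<close>, where \<open>mm j = g - j + 1\<close>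
  makes the genus \<open>g\<close>. Two nonzero elements add up to at least \<open>2 * mm j\<close>,
  so closure is automatic. The choices number \<open>(g - j) choose j\<close>, a diagonal sum of
  binomials.\<close>

lemma fib_le_card_semigroups: "fib (Suc g) \<le> card (semigroups_of_genus g)"
proof -
  define mm where "mm j = g - j + 1" for j
  define A where "A = (SIGMA j:{0..g}. {B. B \<subseteq> {mm j<..<2 * mm j} \<and> card B = j})"
  define G where "G = (\<lambda>(j, B). {1..<mm j} \<union> B)"
  have finB: "finite {B. B \<subseteq> {mm j<..<2 * mm j} \<and> card B = j}" for j
    by (auto intro!: finite_subset[OF _ finite_Pow_iff[THEN iffD2]])
  have "fib (Suc g) = (\<Sum>j = 0..g. (g - j) choose j)" by (rule ne_diagonal_fib[symmetric])
  also have "\<dots> = (\<Sum>j = 0..g. card {B. B \<subseteq> {mm j<..<2 * mm j} \<and> card B = j})"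
  proof (intro sum.cong refl)
    fix j assume "j \<in> {0..g}"
    then have "card {mm j<..<2 * mm j} = g - j" by (auto simp: mm_def)
    then show "(g - j) choose j = card {B. B \<subseteq> {mm j<..<2 * mm j} \<and> card B = j}"
      using n_subsets[of "{mm j<..<2 * mm j}" j] by simp
  qed
  also have "\<dots> = card A" unfolding A_def by (rule card_SigmaI[symmetric]) (auto simp: finB)
  also have "\<dots> = card ((\<lambda>p. - G p) ` A)"
  proof (rule card_image[symmetric], rule inj_onI)
    fix p p' assume p: "p \<in> A" "p' \<in> A" and eq: "- G p = - G p'"
    obtain j B j' B' where pj: "p = (j, B)" "p' = (j', B')" by (cases p, cases p')
    have j: "j \<le> g" "B \<subseteq> {mm j<..<2 * mm j}" "j' \<le> g" "B' \<subseteq> {mm j'<..<2 * mm j'}"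
      using p by (auto simp: pj A_def)
    have eqG: "{1..<mm j} \<union> B = {1..<mm j'} \<union> B'" using eq unfolding pj G_def by (simp only: Compl_eq_Compl_iff prod.case)
    have m1: "1 \<le> mm j" "1 \<le> mm j'" by (simp_all add: mm_def)
    \<comment> \<open>\<open>mm j\<close> is the least positive number that is not a gap, so the gap
      set determines it.\<close>
    have "mm j \<notin> {1..<mm j} \<union> B" "mm j' \<notin> {1..<mm j'} \<union> B'" using j by auto
    then have "mm j \<notin> {1..<mm j'}" "mm j' \<notin> {1..<mm j}" using eqG by auto
    then have mm: "mm j = mm j'" using m1 by auto
    then have "j = j'" using j by (simp add: mm_def)
    moreover have "B = ({1..<mm j} \<union> B) \<inter> {mm j<..}" "B' = ({1..<mm j'} \<union> B') \<inter> {mm j'<..}"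
      using j by auto
    then have "B = B'" using eqG mm by simp
    ultimately show "p = p'" by (simp add: pj)
  qed
  also have "\<dots> \<le> card (semigroups_of_genus g)"
  proof (rule card_mono[OF finite_semigroups_of_genus], clarify)
    fix j B assume "(j, B) \<in> A"
    then have j: "j \<le> g" "B \<subseteq> {mm j<..<2 * mm j}" "card B = j" by (auto simp: A_def)
    let ?S = "- G (j, B)"
    have finB: "finite B" using j(2) finite_subset by blast
    have gaps: "gaps ?S = {1..<mm j} \<union> B" by (auto simp: gaps_def G_def)
    have "card ({1..<mm j} \<union> B) = card {1..<mm j} + card B"
      by (rule card_Un_disjoint) (use finB j in auto)
    then have "genus ?S = g" using j by (simp add: genus_def gaps mm_def)
    moreover have "numerical_semigroup ?S"
      unfolding numerical_semigroup_def
    proof (intro conjI ballI)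
      show "0 \<in> ?S" using j(2) by (auto simp: G_def)
      show "finite (UNIV - ?S)" using finB unfolding gaps[unfolded gaps_def] by simp
      fix x y assume xy: "x \<in> ?S" "y \<in> ?S"
      show "x + y \<in> ?S"
      proof (cases "x = 0 \<or> y = 0")
        case True then show ?thesis using xy by auto
      next
        case False
        then have "mm j \<le> x" "mm j \<le> y" using xy by (auto simp: G_def)
        then have "2 * mm j \<le> x + y" by simp
        moreover have "1 \<le> mm j" by (simp add: mm_def)
        ultimately show ?thesis using j(2) by (auto simp: G_def)
      qed
    qed
    ultimately show "?S \<in> semigroups_of_genus g" by (simp add: semigroups_of_genus_def)
  qed
  finally show ?thesis .
qed

text \<open>Since \<open>psi + psi\<^sup>2 = 1\<close>, each term is a weighted mean of the two
  preceding ones.\<close>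

lemma fib_growth: "1 \<le> real (fib (n + 2)) * psi ^ n"
proof (induction n rule: fib.induct)
  case 1 then show ?case by simp
next
  case 2 then show ?case using psi_bounds by (simp add: numeral_eq_Suc)
next
  case (3 n)
  have "real (fib (Suc (Suc n) + 2)) * psi ^ Suc (Suc n)
      = psi * (real (fib (Suc n + 2)) * psi ^ Suc n) + psi\<^sup>2 * (real (fib (n + 2)) * psi ^ n)"
    by (simp add: algebra_simps power2_eq_square)
  also have "\<dots> \<ge> psi * 1 + psi\<^sup>2 * 1" using 3 by (intro add_mono mult_left_mono) auto
  finally show ?case by (simp add: psi_square)
qed

text \<open>The normalisation: dividing by this quantity turns bounds for
  \<open>card * psi ^ g\<close> into bounds for probabilities.\<close>

lemma card_semigroups_ge: "psi \<le> real (card (semigroups_of_genus g)) * psi ^ g"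
proof -
  have "psi \<le> real (fib (Suc g)) * psi ^ g"
  proof (cases g)
    case (Suc n)
    have "psi * 1 \<le> psi * (real (fib (n + 2)) * psi ^ n)" by (intro mult_left_mono fib_growth) simp
    then show ?thesis by (simp add: Suc algebra_simps)
  qed simp
  also have "\<dots> \<le> real (card (semigroups_of_genus g)) * psi ^ g"
    using fib_le_card_semigroups[of g] by (intro mult_right_mono) auto
  finally show ?thesis .
qed

section \<open>Typical tuples\<close>

text \<open>\<open>1 + psi\<^sup>2\<close> is the mean of a coordinate that takes the value 2 with
  probability \<open>psi\<^sup>2\<close> and otherwise 1. The first sum controls the genus, the
  second enters the sum of the gaps; division by \<open>m\<close> keeps its coefficients in the
  range of \<open>tame_deviation_rate\<close>.\<close>

definition typical :: "real \<Rightarrow> real \<Rightarrow> nat \<Rightarrow> nat \<Rightarrow> (nat \<Rightarrow> nat) \<Rightarrow> bool" where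
  "typical \<eta> \<epsilon> K m k \<longleftrightarrow> tame K \<epsilon> m k \<and>
     \<bar>\<Sum>i\<in>{1..<m}. real (k i) - 1 - psi\<^sup>2\<bar> < \<eta> * m \<and>
     \<bar>\<Sum>i\<in>{1..<m}. real i / m * (real (k i) - 1 - psi\<^sup>2)\<bar> < \<eta> * m"

text \<open>Five exceptional events: failure of tameness, and deviations for the coefficients
  \<open>1\<close>, \<open>-1\<close>, \<open>i / m\<close> and \<open>- i / m\<close>.\<close>

lemma atypical_rate:
  fixes \<eta> :: real
  assumes \<eta>: "0 < \<eta>" "\<eta> \<le> 1"
  shows "\<exists>\<epsilon> K \<kappa>. 0 < \<epsilon> \<and> \<epsilon> \<le> \<eta> \<and> 0 < \<kappa> \<and> (\<forall>\<^sub>F m in sequentially. \<forall>g.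
    real (card {k \<in> kunz_tuples m g. \<not> typical \<eta> \<epsilon> K m k}) * psi ^ g \<le> 5 * exp (- \<kappa> * real m))"
proof -
  obtain \<epsilon>0 \<kappa>1 where \<epsilon>0: "0 < \<epsilon>0" and \<kappa>1: "0 < \<kappa>1" and dev: "\<forall>\<epsilon> K. 0 < \<epsilon> \<longrightarrow> \<epsilon> \<le> \<epsilon>0 \<longrightarrow>
    (\<forall>\<^sub>F m in sequentially. \<forall>g t. (\<forall>i\<in>{1..<m}. \<bar>t i\<bar> \<le> 1) \<longrightarrow>
    real (card {k \<in> kunz_tuples m g. tame K \<epsilon> m k \<and>
      \<eta> * m \<le> (\<Sum>i\<in>{1..<m}. t i * (real (k i) - 1 - psi\<^sup>2))}) * psi ^ g \<le> exp (- \<kappa>1 * real m))"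
    using tame_deviation_rate[OF \<eta>] by blast
  define \<epsilon> where "\<epsilon> = min \<epsilon>0 \<eta>"
  have \<epsilon>: "0 < \<epsilon>" "\<epsilon> \<le> \<epsilon>0" "\<epsilon> \<le> \<eta>" "\<epsilon> \<le> 1" using \<epsilon>0 \<eta> by (auto simp: \<epsilon>_def)
  obtain K \<kappa>2 where \<kappa>2: "0 < \<kappa>2" and wild: "\<forall>\<^sub>F m in sequentially. \<forall>g.
    real (card {k \<in> kunz_tuples m g. \<not> tame K \<epsilon> m k}) * psi ^ g \<le> exp (- \<kappa>2 * real m)"
    using wild_rate[OF \<epsilon>(1,4)] by blast
  define \<kappa> where "\<kappa> = min \<kappa>1 \<kappa>2"
  have "\<forall>\<^sub>F m in sequentially. \<forall>g t. (\<forall>i\<in>{1..<m}. \<bar>t i\<bar> \<le> 1) \<longrightarrow>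
    real (card {k \<in> kunz_tuples m g. tame K \<epsilon> m k \<and>
      \<eta> * m \<le> (\<Sum>i\<in>{1..<m}. t i * (real (k i) - 1 - psi\<^sup>2))}) * psi ^ g \<le> exp (- \<kappa>1 * real m)"
    using dev \<epsilon> by blast
  then have "\<forall>\<^sub>F m in sequentially. \<forall>g.
    real (card {k \<in> kunz_tuples m g. \<not> typical \<eta> \<epsilon> K m k}) * psi ^ g \<le> 5 * exp (- \<kappa> * real m)"
    using wild
  proof eventually_elim
    case (elim m)
    show ?case
    proof
      fix g
      let ?W = "{k \<in> kunz_tuples m g. \<not> tame K \<epsilon> m k}"
      let ?D = "\<lambda>t. {k \<in> kunz_tuples m g. tame K \<epsilon> m k \<and>
        \<eta> * m \<le> (\<Sum>i\<in>{1..<m}. t i * (real (k i) - 1 - psi\<^sup>2))}"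
      let ?E = "exp (- \<kappa> * real m)"
      let ?t = "\<lambda>i. real i / m" and ?u = "\<lambda>i::nat. 1::real"
      have mono: "exp (- \<kappa>1 * real m) \<le> ?E" "exp (- \<kappa>2 * real m) \<le> ?E"
        by (auto simp: \<kappa>_def intro!: mult_right_mono)
      have D: "real (card (?D t)) * psi ^ g \<le> ?E" if "\<forall>i\<in>{1..<m}. \<bar>t i\<bar> \<le> 1" for t
        using elim(1) that mono(1) by (meson order_trans)
      have W: "real (card ?W) * psi ^ g \<le> ?E" using elim(2) mono(2) by (meson order_trans)
      have fin: "finite {k \<in> kunz_tuples m g. P k}" for P using finite_kunz_tuples by simp
      let ?D1 = "?D ?u" and ?D2 = "?D (\<lambda>i. - ?u i)" and ?D3 = "?D ?t" and ?D4 = "?D (\<lambda>i. - ?t i)"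
      have "{k \<in> kunz_tuples m g. \<not> typical \<eta> \<epsilon> K m k} \<subseteq> ?W \<union> (?D1 \<union> (?D2 \<union> (?D3 \<union> ?D4)))"
      proof
        fix k assume k: "k \<in> {k \<in> kunz_tuples m g. \<not> typical \<eta> \<epsilon> K m k}"
        define A where "A = (\<Sum>i\<in>{1..<m}. real (k i) - 1 - psi\<^sup>2)"
        define B where "B = (\<Sum>i\<in>{1..<m}. ?t i * (real (k i) - 1 - psi\<^sup>2))"
        have A: "(\<Sum>i\<in>{1..<m}. ?u i * (real (k i) - 1 - psi\<^sup>2)) = A"
            "(\<Sum>i\<in>{1..<m}. - ?u i * (real (k i) - 1 - psi\<^sup>2)) = - A"
          unfolding A_def sum_negf[symmetric] by (auto intro!: sum.cong)
        have B: "(\<Sum>i\<in>{1..<m}. - ?t i * (real (k i) - 1 - psi\<^sup>2)) = - B"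
          unfolding B_def sum_negf[symmetric] by (auto intro!: sum.cong)
        have "\<not> tame K \<epsilon> m k \<or> tame K \<epsilon> m k \<and> (\<eta> * m \<le> A \<or> \<eta> * m \<le> - A \<or> \<eta> * m \<le> B \<or> \<eta> * m \<le> - B)"
        proof -
          have "\<not> (tame K \<epsilon> m k \<and> \<bar>A\<bar> < \<eta> * m \<and> \<bar>B\<bar> < \<eta> * m)"
            using k by (simp only: typical_def A_def B_def mem_Collect_eq) blast
          then show ?thesis by (auto simp: abs_less_iff not_less)
        qed
        then show "k \<in> ?W \<union> (?D1 \<union> (?D2 \<union> (?D3 \<union> ?D4)))"
          using k unfolding Un_iff mem_Collect_eq A B B_def[symmetric] by blast
      qed
      then have "card {k \<in> kunz_tuples m g. \<not> typical \<eta> \<epsilon> K m k}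
          \<le> card (?W \<union> (?D1 \<union> (?D2 \<union> (?D3 \<union> ?D4))))"
        by (rule card_mono[rotated]) (intro finite_UnI fin)
      also have "\<dots> \<le> card ?W + (card ?D1 + (card ?D2 + (card ?D3 + card ?D4)))"
        using card_Un_le[of ?W "?D1 \<union> (?D2 \<union> (?D3 \<union> ?D4))"] card_Un_le[of ?D1 "?D2 \<union> (?D3 \<union> ?D4)"]
          card_Un_le[of ?D2 "?D3 \<union> ?D4"] card_Un_le[of ?D3 ?D4] by linarith
      finally have "real (card {k \<in> kunz_tuples m g. \<not> typical \<eta> \<epsilon> K m k})
          \<le> real (card ?W) + (real (card (?D ?u)) + (real (card (?D (\<lambda>i. - ?u i)))
            + (real (card (?D ?t)) + real (card (?D (\<lambda>i. - ?t i))))))"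
        by (simp only: of_nat_add[symmetric] of_nat_le_iff)
      then have "real (card {k \<in> kunz_tuples m g. \<not> typical \<eta> \<epsilon> K m k}) * psi ^ g
          \<le> (real (card ?W) + (real (card (?D ?u)) + (real (card (?D (\<lambda>i. - ?u i)))
            + (real (card (?D ?t)) + real (card (?D (\<lambda>i. - ?t i))))))) * psi ^ g"
        by (rule mult_right_mono) simp
      also have "\<dots> \<le> ?E + (?E + (?E + (?E + ?E)))"
        unfolding distrib_right by (intro add_mono W D) auto
      also have "\<dots> = 5 * ?E" by simp
      finally show "real (card {k \<in> kunz_tuples m g. \<not> typical \<eta> \<epsilon> K m k}) * psi ^ g \<le> 5 * ?E" .
    qed
  qed
  moreover have "0 < \<kappa>" using \<kappa>1 \<kappa>2 by (simp add: \<kappa>_def)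
  ultimately show ?thesis using \<epsilon> by blast
qed

lemma sum_atLeastLessThan_real: "(\<Sum>i\<in>{1..<m}. real i) = real m * (real m - 1) / 2"
  by (induction m) (auto simp: sum.atLeastLessThan_Suc field_simps)

lemma sum_progression_real: "(\<Sum>t<n. real (i + t * m)) = real n * i + m * (real n * (real n - 1) / 2)"
  by (induction n) (auto simp: field_simps)

text \<open>With \<open>p = psi\<^sup>2\<close>, the genus is about \<open>(1 + p) * m\<close> and
  the sum of the gaps about \<open>(1/2 + 3/2 * p) * m\<^sup>2\<close>; the rest is bookkeeping of
  errors of order \<open>\<eta> * m\<^sup>2\<close>.\<close>

lemma typical_weight:
  fixes \<eta> :: real and g :: nat
  assumes k: "k \<in> kunz_tuples m g" and ty: "typical \<eta> \<epsilon> K m k" and \<epsilon>: "0 < \<epsilon>" "\<epsilon> \<le> \<eta>" "\<eta> \<le> 1"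
    and m: "2 * K + 2 \<le> m" "real K + 1 \<le> \<eta> * m"
  shows "\<bar>(\<Sum>i\<in>{1..<m}. \<Sum>t<k i. real (i + t * m)) - real g * (real g + 1) / 2 - psi / 10 * (real g)\<^sup>2\<bar>
    \<le> 250 * \<eta> * (real g)\<^sup>2"
proof -
  let ?I = "{1..<m}" and ?p = "psi\<^sup>2"
  define M where "M = real m"
  define s where "s = (\<Sum>i\<in>?I. real (k i) - 1)"
  define Y where "Y = (\<Sum>i\<in>?I. real i * (real (k i) - 1))"
  \<comment> \<open>The quadratic part of the gap sum vanishes on coordinates 1 and 2, so tameness
    makes it negligible.\<close>
  define R where "R = (\<Sum>i\<in>?I. (real (k i) - 1) * (real (k i) - 2) / 2)"
  define G where "G = (\<Sum>i\<in>?I. \<Sum>t<k i. real (i + t * m))"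
  have tame: "tame K \<epsilon> m k" using ty by (simp add: typical_def)
  have M2: "2 \<le> M" using m(1) by (simp add: M_def)
  have cardI: "real (card ?I) = M - 1" using m(1) by (simp add: M_def)
  have p: "0 \<le> ?p" "?p \<le> 1" "?p = 1 - psi" by (simp_all add: psi_square)
  have \<eta>M: "1 \<le> \<eta> * M" using m(2) by (simp add: M_def)
  have \<eta>MM: "M \<le> \<eta> * M\<^sup>2"
    using mult_right_mono[OF \<eta>M, of M] M2 by (simp add: power2_eq_square)
  have g: "real g = M - 1 + s"
  proof -
    have "sum k ?I = g" using k by (simp add: kunz_tuples_def)
    then have "real g = (\<Sum>i\<in>?I. real (k i))" by (metis of_nat_sum)
    also have "\<dots> = s + real (card ?I)" by (simp add: s_def sum_subtractf)
    finally show ?thesis using cardI by simp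
  qed
  have s0: "0 \<le> s" unfolding s_def using kunz_tuples_mem(1)[OF k] by (intro sum_nonneg) fastforce
  have s: "\<bar>s - ?p * (M - 1)\<bar> \<le> \<eta> * M"
  proof -
    have "(\<Sum>i\<in>?I. real (k i) - 1 - ?p) = s - ?p * real (card ?I)" by (simp add: s_def sum_subtractf)
    then show ?thesis using ty cardI by (simp add: typical_def M_def)
  qed
  have Y: "\<bar>Y - ?p * (M * (M - 1) / 2)\<bar> \<le> \<eta> * M\<^sup>2"
  proof -
    have "M * (\<Sum>i\<in>?I. real i / M * (real (k i) - 1 - ?p)) = (\<Sum>i\<in>?I. real i * (real (k i) - 1) - ?p * real i)"
      using M2 by (simp add: sum_distrib_left algebra_simps)
    also have "\<dots> = Y - ?p * (M * (M - 1) / 2)"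
      using sum_atLeastLessThan_real[of m] by (simp add: Y_def sum_subtractf M_def flip: sum_distrib_left)
    finally have eq: "Y - ?p * (M * (M - 1) / 2) = M * (\<Sum>i\<in>?I. real i / M * (real (k i) - 1 - ?p))" ..
    have "\<bar>\<Sum>i\<in>?I. real i / M * (real (k i) - 1 - ?p)\<bar> \<le> \<eta> * M" using ty by (simp add: typical_def M_def)
    then have "M * \<bar>\<Sum>i\<in>?I. real i / M * (real (k i) - 1 - ?p)\<bar> \<le> M * (\<eta> * M)"
      using M2 by (intro mult_left_mono) auto
    then show ?thesis unfolding eq using M2 by (simp add: abs_mult power2_eq_square mult.left_commute)
  qed
  have G: "G = M * (M - 1) / 2 + Y + M * s + M * R"
  proof -
    have "G = (\<Sum>i\<in>?I. real i + real i * (real (k i) - 1) + M * (real (k i) - 1)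
        + M * ((real (k i) - 1) * (real (k i) - 2) / 2))"
      unfolding G_def sum_progression_real by (intro sum.cong refl) (simp add: M_def field_simps)
    also have "\<dots> = (\<Sum>i\<in>?I. real i) + Y + M * s + M * R"
      by (simp only: sum.distrib Y_def s_def R_def sum_distrib_left)
    finally show ?thesis by (simp only: sum_atLeastLessThan_real M_def)
  qed
  have R: "0 \<le> R" "R \<le> 30 * \<eta> * M"
  proof -
    let ?h = "\<lambda>i. (real (k i) - 1) * (real (k i) - 2) / 2"
    \<comment> \<open>The value 15 is \<open>(7 - 1) * (7 - 2) / 2\<close>.\<close>
    have h: "0 \<le> ?h i \<and> ?h i \<le> (if 3 \<le> k i then 15 else 0)" if i: "i \<in> ?I" for i
    proof -
      have "k i \<in> {1..7}" using kunz_tuples_mem(1)[OF k i] tame_le_7[OF k tame m(1) i] by simp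
      then have "k i \<in> {1, 2, 3, 4, 5, 6, 7}" by auto
      then show ?thesis by auto
    qed
    show "0 \<le> R" unfolding R_def by (intro sum_nonneg) (use h in blast)
    have "R \<le> (\<Sum>i\<in>?I. if 3 \<le> k i then 15 else 0)" unfolding R_def by (intro sum_mono) (use h in blast)
    also have "\<dots> = 15 * real (card {i \<in> ?I. 3 \<le> k i})" by (simp flip: sum.inter_filter)
    also have "\<dots> \<le> 15 * (\<epsilon> * M + K + 1)"
      using tame_card_ge_3[OF tame] \<epsilon> by (simp add: M_def)
    also have "\<dots> \<le> 15 * (\<eta> * M + \<eta> * M)"
    proof -
      have "\<epsilon> * M \<le> \<eta> * M" using \<epsilon> M2 by (intro mult_right_mono) auto
      then show ?thesis using m(2) by (simp add: M_def)
    qed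
    also have "\<dots> = 30 * \<eta> * M" by simp
    finally show "R \<le> 30 * \<eta> * M" .
  qed
  have p2M: "0 \<le> (1 + ?p) * M" "(1 + ?p) * M \<le> 2 * M"
  proof -
    show "0 \<le> (1 + ?p) * M" by (rule mult_nonneg_nonneg) (use p(1) M2 in linarith)+
    show "(1 + ?p) * M \<le> 2 * M" by (rule mult_right_mono) (use p(2) M2 in linarith)+
  qed
  define e where "e = real g - (1 + ?p) * M"
  have e: "\<bar>e\<bar> \<le> 3 * \<eta> * M" 
  proof -
    have "e = (s - ?p * (M - 1)) - (1 + ?p)" by (simp add: e_def g algebra_simps)
    then show ?thesis using s p(1,2) \<eta>M by linarith
  qed
  have g2: "\<bar>(real g)\<^sup>2 - (1 + ?p)\<^sup>2 * M\<^sup>2\<bar> \<le> 21 * \<eta> * M\<^sup>2"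
  proof -
    have "(real g)\<^sup>2 - (1 + ?p)\<^sup>2 * M\<^sup>2 = e * (2 * (1 + ?p) * M + e)"
      by (simp add: e_def power2_eq_square algebra_simps)
    moreover have "\<bar>e * (2 * (1 + ?p) * M + e)\<bar> \<le> (3 * \<eta> * M) * (7 * M)"
      unfolding abs_mult
    proof (rule mult_mono[OF e])
      have "3 * \<eta> * M \<le> 3 * 1 * M" using \<epsilon> M2 by (intro mult_right_mono mult_left_mono) auto
      moreover note p2M
      ultimately show "\<bar>2 * (1 + ?p) * M + e\<bar> \<le> 7 * M" using e by linarith
    qed (use \<epsilon> M2 in auto)
    ultimately show ?thesis by (simp add: power2_eq_square mult_ac)
  qed
  have gle: "real g \<le> 5 * M"
  proof -
    have "3 * \<eta> * M \<le> 3 * 1 * M" using \<epsilon> M2 by (intro mult_right_mono mult_left_mono) auto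
    with p2M show ?thesis using e unfolding e_def by linarith
  qed
  have Gest: "\<bar>G - (1/2 + 3/2 * ?p) * M\<^sup>2\<bar> \<le> 35 * \<eta> * M\<^sup>2"
  proof -
    have 1: "\<bar>M * (s - ?p * (M - 1))\<bar> \<le> M * (\<eta> * M)"
      unfolding abs_mult using M2 s by (intro mult_mono) auto
    have 2: "0 \<le> M * R" "M * R \<le> M * (30 * \<eta> * M)" using R M2 by (auto intro!: mult_left_mono)
    have 3: "0 \<le> ?p * M" "?p * M \<le> 1 * M" using p(1,2) M2 by (auto intro!: mult_right_mono simp del: mult_1)
    have eq: "G - (1/2 + 3/2 * ?p) * M\<^sup>2
        = (Y - ?p * (M * (M - 1) / 2)) + M * (s - ?p * (M - 1)) + M * R - M / 2 - 3/2 * (?p * M)"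
      unfolding G by (simp add: power2_eq_square field_simps)
    have 4: "M * (\<eta> * M) = \<eta> * M\<^sup>2" "M * (30 * \<eta> * M) = 30 * (\<eta> * M\<^sup>2)" by (simp_all add: power2_eq_square)
    have "\<bar>G - (1/2 + 3/2 * ?p) * M\<^sup>2\<bar> \<le> 35 * (\<eta> * M\<^sup>2)"
      unfolding eq using 1 2 3 Y \<eta>MM unfolding 4 by linarith
    then show ?thesis by simp
  qed
  \<comment> \<open>Source of the limit constant: on the right, \<open>1/2\<close> matches the
    subtracted \<open>g * (g + 1) / 2\<close>, and \<open>psi / 10\<close> is what remains for the
    weight.\<close>
  have id: "1/2 + 3/2 * ?p = (1/2 + psi / 10) * (1 + ?p)\<^sup>2"
  proof -
    have sq: "(1 + ?p)\<^sup>2 = 5 - 5 * psi"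
      unfolding p(3) by (simp add: power2_eq_square algebra_simps psi_mult)
    have prod: "(1/2 + psi / 10) * (5 - 5 * psi) = 5/2 - 2 * psi - psi * psi / 2" by (simp add: field_simps)
    show ?thesis unfolding sq unfolding p(3) prod psi_mult by (simp add: field_simps)
  qed
  have c: "0 \<le> 1/2 + psi / 10" "1/2 + psi / 10 \<le> 1" using psi_bounds by auto
  have "\<bar>G - real g * (real g + 1) / 2 - psi / 10 * (real g)\<^sup>2\<bar>
      = \<bar>(G - (1/2 + 3/2 * ?p) * M\<^sup>2) - real g / 2 - (1/2 + psi / 10) * ((real g)\<^sup>2 - (1 + ?p)\<^sup>2 * M\<^sup>2)\<bar>"
    unfolding id by (simp add: power2_eq_square algebra_simps add_divide_distrib)
  also have "\<dots> \<le> 62 * (\<eta> * M\<^sup>2)"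
  proof -
    have "\<bar>(1/2 + psi / 10) * ((real g)\<^sup>2 - (1 + ?p)\<^sup>2 * M\<^sup>2)\<bar> \<le> 1 * (21 * \<eta> * M\<^sup>2)"
      unfolding abs_mult using c g2 by (intro mult_mono) auto
    then show ?thesis using Gest gle \<eta>MM by linarith
  qed
  \<comment> \<open>Passing from \<open>M\<close> to \<open>2 * g\<close> multiplies 62 by 4, which
    gives 248.\<close>
  also have "\<dots> \<le> 62 * (\<eta> * (2 * real g)\<^sup>2)"
  proof -
    have "M \<le> 2 * real g" using g s0 M2 by simp
    then show ?thesis using \<epsilon> M2 by (intro mult_left_mono power_mono) auto
  qed
  also have "\<dots> \<le> 250 * \<eta> * (real g)\<^sup>2" using \<epsilon> by (simp add: power_mult_distrib)
  finally show ?thesis by (simp add: G_def)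
qed

section \<open>Concentration of the weight\<close>

text \<open>With weight \<open>2 / 3\<close> per unit in place of \<open>psi\<close>, a coordinate
  has total mass at most 2. The growth rate \<open>3 / 2\<close> in \<open>g\<close> is below the
  golden ratio, which wins when \<open>m\<close> is small against \<open>g\<close>.\<close>

lemma card_kunz_tuples_le: "real (card (kunz_tuples m g)) * (2 / 3) ^ g \<le> 2 ^ (m - 1)"
proof -
  have "real (card (kunz_tuples m g)) * (2 / 3) ^ g \<le> (\<Prod>i\<in>{1..<m}. \<Sum>v\<in>{1..g}. (2 / 3 :: real) ^ v)"
    by (rule card_PiE_weighted_le) (auto simp: kunz_tuples_def power_sum)
  also have "\<dots> \<le> (\<Prod>i\<in>{1..<m}. 2)"
  proof (intro prod_mono conjI)
    have "(\<Sum>v=1..g. (2 / 3 :: real) ^ v) = 2 - 2 * (2 / 3) ^ g" by (induction g) auto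
    then show "(\<Sum>v=1..g. (2 / 3 :: real) ^ v) \<le> 2" by simp
  qed (auto intro!: sum_nonneg)
  finally show ?thesis by simp
qed

lemma small_multiplicity_rate:
  assumes "20 * m \<le> g"
  shows "real (card (kunz_tuples m g)) * psi ^ g \<le> exp (- real g / 50)"
proof -
  have "psi ^ g = (3 / 2 * psi) ^ g * (2 / 3) ^ g" by (simp flip: power_mult_distrib)
  then have "real (card (kunz_tuples m g)) * psi ^ g
      = (3 / 2 * psi) ^ g * (real (card (kunz_tuples m g)) * (2 / 3) ^ g)" by simp
  also have "\<dots> \<le> exp (- 7 / 100) ^ g * exp (real g / 20)"
  proof (rule mult_mono)
    \<comment> \<open>The rates \<open>- 7 / 100\<close> from this factor and \<open>1 / 20\<close>
      from the \<open>2 ^ (m - 1)\<close> tuples add up to \<open>- 1 / 50\<close>.\<close>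
    have "3 / 2 * psi \<le> 1 + - 7 / 100" using psi_bounds by simp
    also have "\<dots> \<le> exp (- 7 / 100)" by (rule exp_ge_add_one_self)
    finally show "(3 / 2 * psi) ^ g \<le> exp (- 7 / 100) ^ g" by (intro power_mono) auto
    have "real (card (kunz_tuples m g)) * (2 / 3) ^ g \<le> 2 ^ (m - 1)" by (rule card_kunz_tuples_le)
    also have "\<dots> \<le> (2::real) ^ m" by (intro power_increasing) auto
    also have "\<dots> \<le> exp 1 ^ m" using exp_ge_add_one_self[of 1] by (intro power_mono) auto
    also have "\<dots> = exp (real m)" using exp_of_nat_mult[of m "1::real"] by simp
    also have "\<dots> \<le> exp (real g / 20)" using assms by simp
    finally show "real (card (kunz_tuples m g)) * (2 / 3) ^ g \<le> exp (real g / 20)" .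
  qed auto
  also have "\<dots> = exp (- real g / 50)"
    by (simp add: mult_exp_exp flip: exp_of_nat_mult) 
  finally show ?thesis .
qed

lemma weight_deviation_le:
  fixes \<eta> :: real
  assumes S: "S \<in> semigroups_of_genus g" and ty: "typical \<eta> \<epsilon> K (multiplicity_of S) (kunz S)"
    and \<epsilon>: "0 < \<epsilon>" "\<epsilon> \<le> \<eta>" "\<eta> \<le> 1"
    and m: "2 * K + 2 \<le> multiplicity_of S" "real K + 1 \<le> \<eta> * multiplicity_of S"
  shows "\<bar>real_of_int (weight S) - psi / 10 * (real g)\<^sup>2\<bar> \<le> 250 * \<eta> * (real g)\<^sup>2"
proof -
  let ?m = "multiplicity_of S"
  have ns: "numerical_semigroup S" and g: "genus S = g" using S by (auto simp: semigroups_of_genus_def)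
  have k: "kunz S \<in> kunz_tuples ?m g" using kunz_mem_kunz_tuples[OF ns] g by simp
  have "real_of_int (weight S) = (\<Sum>x\<in>gaps S. real x) - real (g * (g + 1) div 2)"
    by (simp add: weight_def g)
  also have "(\<Sum>x\<in>gaps S. real x) = (\<Sum>i\<in>{1..<?m}. \<Sum>t<kunz S i. real (i + t * ?m))"
    unfolding gaps_eq_kunz_gaps[OF ns] by (rule sum_kunz_gaps)
  also have "real (g * (g + 1) div 2) = real g * (real g + 1) / 2"
    by (subst real_of_nat_div) (auto simp: algebra_simps)
  finally show ?thesis using typical_weight[OF k ty \<epsilon> m] by simp
qed

lemma linear_times_exp_tendsto_0:
  assumes "0 < c"
  shows "(\<lambda>n. (real n + 1) * exp (- c * real n)) \<longlonglongrightarrow> 0"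
proof -
  have "(\<lambda>n. real n * exp (- c) ^ n + exp (- c) ^ n) \<longlonglongrightarrow> 0 + 0"
    using assms by (intro tendsto_add powser_times_n_limit_0 LIMSEQ_realpow_zero) auto
  then show ?thesis unfolding exp_of_nat2_mult distrib_right by simp
qed

text \<open>Multiplicities up to \<open>g / 20\<close> fall to
  \<open>small_multiplicity_rate\<close>. Beyond that, an exceptional weight forces an atypical
  tuple by \<open>weight_deviation_le\<close>, and these decay like
  \<open>exp (- \<kappa> * g / 20)\<close>. Summing over the \<open>g + 1\<close> multiplicities
  costs only a linear factor.\<close>

lemma atypical_semigroups_rate:
  fixes \<epsilon> :: real
  assumes "0 < \<epsilon>"
  shows "(\<lambda>g. real (card {S \<in> semigroups_of_genus g.
      \<not> \<bar>real_of_int (weight S) - psi / 10 * (real g)\<^sup>2\<bar> < \<epsilon> * (real g)\<^sup>2})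
    / real (card (semigroups_of_genus g))) \<longlonglongrightarrow> 0" (is "(\<lambda>g. real (card (?B g)) / ?N g) \<longlonglongrightarrow> 0")
proof -
  \<comment> \<open>The divisor 300 exceeds the factor 250 of \<open>weight_deviation_le\<close>,
    which makes the comparison with \<open>\<epsilon>\<close> strict.\<close>
  define \<eta> where "\<eta> = min 1 (\<epsilon> / 300)"
  have \<eta>: "0 < \<eta>" "\<eta> \<le> 1" "300 * \<eta> \<le> \<epsilon>" using assms by (auto simp: \<eta>_def)
  obtain \<delta> K \<kappa> where \<delta>: "0 < \<delta>" "\<delta> \<le> \<eta>" and \<kappa>: "0 < \<kappa>" and "\<forall>\<^sub>F m in sequentially. \<forall>g.
    real (card {k \<in> kunz_tuples m g. \<not> typical \<eta> \<delta> K m k}) * psi ^ g \<le> 5 * exp (- \<kappa> * real m)"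
    using atypical_rate[OF \<eta>(1,2)] by blast
  then obtain m0 where m0: "\<And>m g. m0 \<le> m \<Longrightarrow>
    real (card {k \<in> kunz_tuples m g. \<not> typical \<eta> \<delta> K m k}) * psi ^ g \<le> 5 * exp (- \<kappa> * real m)"
    unfolding eventually_sequentially by blast
  obtain m1 where m1: "(real K + 1) / \<eta> \<le> real m1" using real_arch_simple by blast
  define m2 where "m2 = max (max m0 m1) (2 * K + 2)"
  define b where "b g = (real g + 1) * (exp (- real g / 50) + 5 * exp (- \<kappa> * (real g / 20)))" for g
  have bound: "real (card (?B g)) / ?N g \<le> b g / psi" if g: "20 * m2 \<le> g" "1 \<le> g" for g
  proof -
    define P where "P m k \<longleftrightarrow> 20 * m \<le> g \<or> \<not> typical \<eta> \<delta> K m k" for m k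
    have "?B g \<subseteq> {S \<in> semigroups_of_genus g. P (multiplicity_of S) (kunz S)}"
    proof
      fix S assume S: "S \<in> ?B g"
      have "P (multiplicity_of S) (kunz S)"
      proof (rule ccontr)
        let ?m = "multiplicity_of S"
        assume "\<not> ?thesis"
        then have lt: "g < 20 * ?m" and ty: "typical \<eta> \<delta> K ?m (kunz S)" by (auto simp: P_def)
        then have "m2 < ?m" using g by linarith
        then have mm: "2 * K + 2 \<le> ?m" "m1 \<le> ?m" by (auto simp: m2_def)
        have "(real K + 1) / \<eta> \<le> real ?m" using m1 mm(2) by linarith
        then have K: "real K + 1 \<le> \<eta> * ?m" using \<eta> by (simp add: field_simps)
        have "\<bar>real_of_int (weight S) - psi / 10 * (real g)\<^sup>2\<bar> \<le> 250 * \<eta> * (real g)\<^sup>2"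
          by (rule weight_deviation_le[OF _ ty \<delta> \<eta>(2) mm(1) K]) (use S in simp)
        also have "\<dots> < \<epsilon> * (real g)\<^sup>2" using \<eta> g by (intro mult_strict_right_mono) auto
        finally show False using S by simp
      qed
      then show "S \<in> {S \<in> semigroups_of_genus g. P (multiplicity_of S) (kunz S)}" using S by simp
    qed
    then have "card (?B g) \<le> card {S \<in> semigroups_of_genus g. P (multiplicity_of S) (kunz S)}"
      by (rule card_mono[rotated]) (simp add: finite_semigroups_of_genus)
    also have "\<dots> \<le> (\<Sum>m\<in>{1..g+1}. card {k \<in> kunz_tuples m g. P m k})" by (rule card_semigroups_le)
    finally have "real (card (?B g)) * psi ^ g \<le> real (\<Sum>m\<in>{1..g+1}. card {k \<in> kunz_tuples m g. P m k}) * psi ^ g"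
      by (intro mult_right_mono) (simp_all only: of_nat_le_iff psi_pos zero_le_power)
    also have "\<dots> = (\<Sum>m\<in>{1..g+1}. real (card {k \<in> kunz_tuples m g. P m k}) * psi ^ g)"
      by (simp only: of_nat_sum sum_distrib_right)
    also have "\<dots> \<le> (\<Sum>m\<in>{1..g+1}. exp (- real g / 50) + 5 * exp (- \<kappa> * (real g / 20)))"
    proof (rule sum_mono)
      fix m
      show "real (card {k \<in> kunz_tuples m g. P m k}) * psi ^ g
          \<le> exp (- real g / 50) + 5 * exp (- \<kappa> * (real g / 20))"
      proof (cases "20 * m \<le> g")
        case True
        then have eq: "{k \<in> kunz_tuples m g. P m k} = kunz_tuples m g" by (simp add: P_def)
        have "0 \<le> 5 * exp (- \<kappa> * (real g / 20))" by simp
        then show ?thesis unfolding eq using small_multiplicity_rate[OF True] by linarith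
      next
        case False
        then have eq: "{k \<in> kunz_tuples m g. P m k} = {k \<in> kunz_tuples m g. \<not> typical \<eta> \<delta> K m k}"
          by (simp add: P_def)
        have "m0 \<le> m2" by (simp add: m2_def)
        then have "m0 \<le> m" using False g(1) by linarith
        then have "real (card {k \<in> kunz_tuples m g. \<not> typical \<eta> \<delta> K m k}) * psi ^ g \<le> 5 * exp (- \<kappa> * real m)"
          by (rule m0)
        moreover have "exp (- \<kappa> * real m) \<le> exp (- \<kappa> * (real g / 20))"
          using False \<kappa> by simp
        moreover have "0 \<le> exp (- real g / 50)" by simp
        ultimately show ?thesis unfolding eq by linarith
      qed
    qed
    also have "\<dots> = b g" by (simp add: b_def add.commute)
    finally have le: "real (card (?B g)) * psi ^ g \<le> b g" .
    have "real (card (?B g)) / ?N g = (real (card (?B g)) * psi ^ g) / (?N g * psi ^ g)" by simp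
    also have "\<dots> \<le> b g / psi"
      using le card_semigroups_ge[of g] by (intro frac_le) (auto simp: b_def)
    finally show ?thesis .
  qed
  have "(\<lambda>g. b g / psi) \<longlonglongrightarrow> 0"
  proof -
    have "(\<lambda>g. (real g + 1) * exp (- (1 / 50) * real g) + 5 * ((real g + 1) * exp (- (\<kappa> / 20) * real g)))
        \<longlonglongrightarrow> 0 + 5 * 0"
      by (intro tendsto_add tendsto_mult tendsto_const linear_times_exp_tendsto_0) (use \<kappa> in auto)
    moreover have "b = (\<lambda>g. (real g + 1) * exp (- (1 / 50) * real g)
        + 5 * ((real g + 1) * exp (- (\<kappa> / 20) * real g)))"
      by (rule ext) (simp add: b_def distrib_left)
    ultimately have "b \<longlonglongrightarrow> 0" by simp
    then show ?thesis using tendsto_divide[of b 0 sequentially "\<lambda>_. psi" psi] by simp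
  qed
  then show ?thesis
  proof (rule tendsto_sandwich[rotated -1])
    show "\<forall>\<^sub>F g in sequentially. real (card (?B g)) / ?N g \<le> b g / psi"
      using eventually_ge_at_top[of "max (20 * m2) 1"] by eventually_elim (rule bound, auto)
  qed auto
qed

lemma golden_coefficient: "1 / (10 * golden_ratio) = psi / 10"
proof -
  have "golden_ratio \<noteq> 0" using golden_pos less_irrefl by metis
  with psi_golden show ?thesis by (simp add: field_simps)
qed

theorem theorem1p7:
  shows "((\<lambda>g. expect_g g (\<lambda>S. real_of_int (weight S)) / (real g)^2)
            \<longlonglongrightarrow> 1 / (10 * golden_ratio))
       \<and> (\<forall>\<epsilon>::real. \<epsilon> > 0 \<longrightarrow>
           ((\<lambda>g. prob_g g (\<lambda>S. \<bar>real_of_int (weight S) - 1 / (10 * golden_ratio) * (real g)^2\<bar>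
                               < \<epsilon> * (real g)^2))
            \<longlonglongrightarrow> 1))"
proof (intro conjI allI impI)
  let ?Sg = semigroups_of_genus and ?c = "psi / 10"
  let ?near = "\<lambda>\<epsilon> g S. \<bar>real_of_int (weight S) - ?c * (real g)\<^sup>2\<bar> < \<epsilon> * (real g)\<^sup>2"
  define r where "r \<epsilon> g = real (card {S \<in> ?Sg g. \<not> ?near \<epsilon> g S}) / real (card (?Sg g))" for \<epsilon> g
  have r: "r \<epsilon> \<longlonglongrightarrow> 0" if "0 < \<epsilon>" for \<epsilon>
    using atypical_semigroups_rate[OF that] by (simp add: r_def[abs_def])
  have card_pos: "0 < real (card (?Sg g))" for g
  proof (rule ccontr)
    assume "\<not> ?thesis"
    then have "real (card (?Sg g)) = 0" by simp
    with card_semigroups_ge[of g] psi_pos(1) show False by simp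
  qed
  {
    fix \<epsilon> :: real assume "\<epsilon> > 0"
    have "prob_g g (?near \<epsilon> g) = 1 - r \<epsilon> g" for g
    proof -
      let ?A = "{S \<in> ?Sg g. ?near \<epsilon> g S}" and ?B = "{S \<in> ?Sg g. \<not> ?near \<epsilon> g S}"
      have "?Sg g = ?A \<union> ?B" by blast
      then have "card (?Sg g) = card (?A \<union> ?B)" by (rule arg_cong)
      also have "\<dots> = card ?A + card ?B"
        by (rule card_Un_disjoint) (use finite_semigroups_of_genus in auto)
      finally have "real (card ?A) = real (card (?Sg g)) - real (card ?B)" by linarith
      then have "prob_g g (?near \<epsilon> g) = (real (card (?Sg g)) - real (card ?B)) / real (card (?Sg g))"
        unfolding prob_g_def by (rule arg_cong)
      also have "\<dots> = 1 - r \<epsilon> g"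
        unfolding r_def diff_divide_distrib using card_pos[of g] by simp
      finally show ?thesis .
    qed
    then have "(\<lambda>g. prob_g g (?near \<epsilon> g)) = (\<lambda>g. 1 - r \<epsilon> g)" by (rule ext)
    moreover have "(\<lambda>g. 1 - r \<epsilon> g) \<longlonglongrightarrow> 1 - 0"
      by (intro tendsto_diff tendsto_const r \<open>\<epsilon> > 0\<close>)
    ultimately show "(\<lambda>g. prob_g g (\<lambda>S. \<bar>real_of_int (weight S) - 1 / (10 * golden_ratio) * (real g)^2\<bar>
        < \<epsilon> * (real g)^2)) \<longlonglongrightarrow> 1"
      unfolding golden_coefficient by simp
  }
  \<comment> \<open>Off the concentration event the deviation is at most
    \<open>3 * g\<^sup>2\<close>: 2 from \<open>weight_bounds\<close>, 1 from the centre
    \<open>psi / 10\<close>. So convergence in probability passes to the mean.\<close>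
  have dev: "\<bar>expect_g g (\<lambda>S. real_of_int (weight S)) / (real g)\<^sup>2 - ?c\<bar> \<le> \<epsilon> + 3 * r \<epsilon> g"
    if g: "1 \<le> g" and \<epsilon>: "0 < \<epsilon>" for g \<epsilon>
  proof -
    let ?w = "\<lambda>S. real_of_int (weight S)" and ?n = "real (card (?Sg g))"
    have g2: "0 < (real g)\<^sup>2" using g by simp
    have "\<bar>\<Sum>S\<in>?Sg g. ?w S - ?c * (real g)\<^sup>2\<bar> \<le> (\<Sum>S\<in>?Sg g. \<bar>?w S - ?c * (real g)\<^sup>2\<bar>)" by (rule sum_abs)
    also have "\<dots> \<le> (\<Sum>S\<in>?Sg g. \<epsilon> * (real g)\<^sup>2 + (if ?near \<epsilon> g S then 0 else 3 * (real g)\<^sup>2))"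
    proof (rule sum_mono)
      fix S assume "S \<in> ?Sg g"
      then have "\<bar>?w S\<bar> \<le> 2 * (real g)\<^sup>2" using weight_bounds by (auto simp: semigroups_of_genus_def)
      moreover have "?c * (real g)\<^sup>2 \<le> 1 * (real g)\<^sup>2"
        by (rule mult_right_mono) (use psi_bounds in auto)
      moreover have "0 \<le> ?c * (real g)\<^sup>2" by simp
      moreover have "0 \<le> \<epsilon> * (real g)\<^sup>2" using \<epsilon> by simp
      ultimately have le: "\<bar>?w S - ?c * (real g)\<^sup>2\<bar> \<le> \<epsilon> * (real g)\<^sup>2 + 3 * (real g)\<^sup>2" by linarith
      show "\<bar>?w S - ?c * (real g)\<^sup>2\<bar> \<le> \<epsilon> * (real g)\<^sup>2 + (if ?near \<epsilon> g S then 0 else 3 * (real g)\<^sup>2)"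
      proof (cases "?near \<epsilon> g S")
        case True
        then show ?thesis by simp
      next
        case False
        then show ?thesis using le by (simp only: if_False)
      qed
    qed
    also have "\<dots> = ?n * (\<epsilon> * (real g)\<^sup>2) + real (card {S \<in> ?Sg g. \<not> ?near \<epsilon> g S}) * (3 * (real g)\<^sup>2)"
    proof -
      have "(\<Sum>S\<in>?Sg g. if ?near \<epsilon> g S then 0 else 3 * (real g)\<^sup>2)
          = (\<Sum>S\<in>?Sg g. if \<not> ?near \<epsilon> g S then 3 * (real g)\<^sup>2 else 0)"
        by (intro sum.cong refl) simp
      also have "\<dots> = (\<Sum>S | S \<in> ?Sg g \<and> \<not> ?near \<epsilon> g S. 3 * (real g)\<^sup>2)"
        by (rule sum.inter_filter[symmetric]) (rule finite_semigroups_of_genus)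
      finally show ?thesis by (simp add: sum.distrib)
    qed
    also have "\<dots> = (\<epsilon> + 3 * r \<epsilon> g) * (?n * (real g)\<^sup>2)"
      using card_pos[of g] by (simp add: r_def field_simps)
    finally have *: "\<bar>\<Sum>S\<in>?Sg g. ?w S - ?c * (real g)\<^sup>2\<bar> \<le> (\<epsilon> + 3 * r \<epsilon> g) * (?n * (real g)\<^sup>2)" .
    have "expect_g g ?w / (real g)\<^sup>2 - ?c = (\<Sum>S\<in>?Sg g. ?w S - ?c * (real g)\<^sup>2) / (?n * (real g)\<^sup>2)"
    proof -
      have split: "x / n / q - c = (x - n * (c * q)) / (n * q)" if "0 < n" "0 < q" for x n q c :: real
        using that by (simp add: field_simps)
      show ?thesis
        unfolding expect_g_def sum_subtractf sum_constant by (rule split[OF card_pos g2])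
    qed
    then have "\<bar>expect_g g ?w / (real g)\<^sup>2 - ?c\<bar> = \<bar>\<Sum>S\<in>?Sg g. ?w S - ?c * (real g)\<^sup>2\<bar> / (?n * (real g)\<^sup>2)"
      using card_pos[of g] g2 by (simp add: abs_mult)
    also have "\<dots> \<le> \<epsilon> + 3 * r \<epsilon> g"
      using * card_pos[of g] g2 by (subst pos_divide_le_eq) auto
    finally show ?thesis .
  qed
  show "(\<lambda>g. expect_g g (\<lambda>S. real_of_int (weight S)) / (real g)^2) \<longlonglongrightarrow> 1 / (10 * golden_ratio)"
    unfolding golden_coefficient
  proof (rule LIMSEQ_I)
    fix e :: real assume e: "0 < e"
    \<comment> \<open>The two shares are \<open>e / 2\<close> and
      \<open>3 * (e / 6)\<close>.\<close>
    then have "\<forall>\<^sub>F g in sequentially. r (e / 2) g < e / 6"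
      by (intro order_tendstoD(2)[OF r]) auto
    moreover have "\<forall>\<^sub>F g in sequentially. (1::nat) \<le> g" by (rule eventually_ge_at_top)
    ultimately have "\<forall>\<^sub>F g in sequentially.
        norm (expect_g g (\<lambda>S. real_of_int (weight S)) / (real g)\<^sup>2 - ?c) < e"
    proof eventually_elim
      case (elim g)
      then show ?case using dev[of g "e / 2"] e by simp
    qed
    then show "\<exists>n0. \<forall>g\<ge>n0. norm (expect_g g (\<lambda>S. real_of_int (weight S)) / (real g)\<^sup>2 - ?c) < e"
      unfolding eventually_sequentially .
  qed
qed

end
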